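(* Let $\mathcal{D}=(V,\mathscr{E})$ be a directed acyclic graph on $V=\{1,\dots,p\}$, let $\mathscr{V}$ be the edge set of its undirected version, and let $\Gamma\in\mathrm{Q}_{\mathcal{D}}$. Then: (a) There exists a completion process of polynomial complexity that can determine whether $\Gamma$ can be completed in $\mathrm{PD}_{\mathcal{D}}$. (b) If a completion of $\Gamma$ in $\mathrm{PD}_{\mathcal{D}}$ exists, this completion is unique and can be determined constructively using the following process: (1) Set $\Sigma_{ij}=\Gamma_{ij}$ for each $\{i,j\}\in\mathscr{V}$ and set $j=p$. (2) If $j>1$, then set $j=j-1$ and proceed to the next step; otherwise $\Sigma$ is successfully completed. (3) If $\Sigma_{\mathrm{fa}(j)}\succ 0$, then proceed to the next step; otherwise the completion in $\mathrm{PD}_{\mathcal{D}}$ does not exist. (The submatrix $\Sigma_{\mathrm{fa}(j)}$ is fully determined at this stage.) (4) If $\mathrm{pr}(j)$ is empty, then return to step (2); otherwise proceed to the next step. (5) If $\mathrm{pa}(j)$ is non-empty, then set $\Sigma_{\mathrm{pr}(j),j}=\Sigma_{\mathrm{pr}(j),\mathrm{pa}(j)}(\Sigma_{\mathrm{pa}(j)})^{-1}\Sigma_{\mathrm{pa}(j),j}$ and $\Sigma_{j,\mathrm{pr}(j)}=(\Sigma_{\mathrm{pr}(j),j})'$, and return to step (2). If $\mathrm{pa}(j)$ is empty, then set $\Sigma_{\mathrm{pr}(j),j}=0$ (and correspondingly $\Sigma_{j,\mathrm{pr}(j)}=0$) and return to step (2).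
   Context: $\mathcal{D}=(V,\mathscr{E})$ is a directed acyclic graph (DAG: a directed graph with no directed cycles of length greater than 1) on $V=\{1,\dots,p\}$, with vertices numbered so that $i\to j$ (i.e. $(i,j)\in\mathscr{E}$, $i\ne j$) implies $i>j$. By convention edge sets contain all loops. $\mathrm{pa}(j)=\{i\neq j: i\to j\}$, $\mathrm{fa}(j)=\mathrm{pa}(j)\cup\{j\}$, and $\mathrm{pr}(j)=\{i: i>j,\ i\notin \mathrm{pa}(j)\}$. The undirected version of $\mathcal{D}$ is $\mathcal{G}=(V,\mathscr{V})$. A $\mathcal{D}$-partial matrix is a real symmetric function $\Gamma$ on $\{(i,j):\{i,j\}\in\mathscr{V}\}$ (including all diagonal positions), $\Gamma_{ij}=\Gamma_{ji}$. A clique of $\mathcal{D}$ is a maximal set of pairwise adjacent vertices. $\mathrm{Q}_{\mathcal{D}}$ is the set of $\mathcal{D}$-partial matrices $\Gamma$ with $\Gamma_C=(\Gamma_{ij})_{i,j\in C}$ positive definite for every clique $C$ of $\mathcal{D}$. $\Sigma_{A,B}$ is the submatrix with rows in $A$ and columns in $B$; $\Sigma_A=\Sigma_{A,A}$; $'$ denotes transpose; $M\succ0$ means symmetric positive definite. $\mathrm{PD}_{\mathcal{D}}$ is the set of $p\times p$ matrices $\Sigma\succ 0$ such that $\mathrm{N}_p(0,\Sigma)$ obeys the directed local Markov property with respect to $\mathcal{D}$; equivalently, $\Sigma\succ0$ and $\Sigma_{\mathrm{pr}(j),j}=\Sigma_{\mathrm{pr}(j),\mathrm{pa}(j)}(\Sigma_{\mathrm{pa}(j)})^{-1}\Sigma_{\mathrm{pa}(j),j}$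 for all $j\in V$ (right-hand side $0$ if $\mathrm{pa}(j)=\emptyset$). A completion of $\Gamma$ in $\mathrm{PD}_{\mathcal{D}}$ is a $T\in\mathrm{PD}_{\mathcal{D}}$ with $T_{ij}=\Gamma_{ij}$ for each $(i,j)\in\mathscr{E}$ (loops included). Complexity is measured as the number of real arithmetic operations and comparisons, as a function of $p$. *)

theory Defs
  imports Complex_Main "HOL-Computational_Algebra.Polynomial"
begin

section \<open>Directed acyclic graphs\<close>

text \<open>
  A graph on \<open>{1..p}\<close> is given by \<open>p\<close> and its edge set \<open>E\<close>, which contains all loops;
  \<open>(i, j) \<in> E\<close> with \<open>i \<noteq> j\<close> means \<open>i \<rightarrow> j\<close>. A directed cycle of length greater
  than 1 is a cycle of \<open>E - Id\<close>.
\<close>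

definition verts :: "nat \<Rightarrow> nat set" where
  "verts p = {1..p}"

definition dag :: "nat \<Rightarrow> (nat \<times> nat) set \<Rightarrow> bool" where
  "dag p E \<longleftrightarrow> 1 \<le> p \<and> E \<subseteq> verts p \<times> verts p \<and> (\<forall>i\<in>verts p. (i, i) \<in> E) \<and>
     acyclic (E - Id) \<and> (\<forall>i j. (i, j) \<in> E \<and> i \<noteq> j \<longrightarrow> j < i)"

definition pa :: "(nat \<times> nat) set \<Rightarrow> nat \<Rightarrow> nat set" where
  "pa E j = {i. i \<noteq> j \<and> (i, j) \<in> E}"

definition fa :: "(nat \<times> nat) set \<Rightarrow> nat \<Rightarrow> nat set" where
  "fa E j = pa E j \<union> {j}"

definition pr :: "nat \<Rightarrow> (nat \<times> nat) set \<Rightarrow> nat \<Rightarrow> nat set" where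
  "pr p E j = {i \<in> verts p. j < i \<and> i \<notin> pa E j}"

definition undirected :: "(nat \<times> nat) set \<Rightarrow> (nat \<times> nat) set" where
  "undirected E = E \<union> E\<inverse>"

definition pairwise_adjacent :: "nat \<Rightarrow> (nat \<times> nat) set \<Rightarrow> nat set \<Rightarrow> bool" where
  "pairwise_adjacent p E C \<longleftrightarrow>
     C \<subseteq> verts p \<and> (\<forall>i\<in>C. \<forall>j\<in>C. i \<noteq> j \<longrightarrow> (i, j) \<in> undirected E)"

definition clique :: "nat \<Rightarrow> (nat \<times> nat) set \<Rightarrow> nat set \<Rightarrow> bool" where
  "clique p E C \<longleftrightarrow> pairwise_adjacent p E C \<and>
     (\<forall>C'. pairwise_adjacent p E C' \<and> C \<subseteq> C' \<longrightarrow> C' = C)"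


section \<open>Matrices indexed by sets of vertices\<close>

text \<open>
  A matrix is a function of two vertices. A submatrix \<open>M\<^bsub>A,B\<^esub>\<close> is \<open>M\<close> together with the index sets
  \<open>A\<close> and \<open>B\<close>, so notions about submatrices take the index sets as arguments.
\<close>

type_synonym matrix = "nat \<Rightarrow> nat \<Rightarrow> real"

definition pos_def_on :: "nat set \<Rightarrow> matrix \<Rightarrow> bool" where
  "pos_def_on A M \<longleftrightarrow> (\<forall>i\<in>A. \<forall>j\<in>A. M i j = M j i) \<and>
     (\<forall>x :: nat \<Rightarrow> real. (\<exists>i\<in>A. x i \<noteq> 0) \<longrightarrow> (\<Sum>i\<in>A. \<Sum>j\<in>A. x i * M i j * x j) > 0)"

text \<open>The inverse of \<open>M\<^bsub>A,A\<^esub>\<close>, padded with zeros outside \<open>A \<times> A\<close> (unspecified if singular).\<close>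

definition inverse_on :: "nat set \<Rightarrow> matrix \<Rightarrow> matrix" where
  "inverse_on A M = (THE B.
     (\<forall>i j. \<not> (i \<in> A \<and> j \<in> A) \<longrightarrow> B i j = 0) \<and>
     (\<forall>i\<in>A. \<forall>j\<in>A. (\<Sum>k\<in>A. M i k * B k j) = (if i = j then 1 else 0)) \<and>
     (\<forall>i\<in>A. \<forall>j\<in>A. (\<Sum>k\<in>A. B i k * M k j) = (if i = j then 1 else 0)))"

text \<open>
  The \<open>i\<close>-th entry of the column \<open>M\<^bsub>B,A\<^esub> (M\<^bsub>A,A\<^esub>)\<^sup>-\<^sup>1 M\<^bsub>A,j\<^esub>\<close>, for \<open>i \<in> B\<close>. It is \<open>0\<close> if \<open>A = {}\<close>.
\<close>

definition regress :: "nat set \<Rightarrow> matrix \<Rightarrow> nat \<Rightarrow> nat \<Rightarrow> real" where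
  "regress A M i j = (\<Sum>k\<in>A. \<Sum>l\<in>A. M i k * inverse_on A M k l * M l j)"

text \<open>
  The matrices of \<open>N\<^sub>p(0, \<Sigma>)\<close> with the directed local Markov property: \<open>\<Sigma>\<close> is positive definite and
  \<open>\<Sigma>\<^bsub>pr(j),j\<^esub> = \<Sigma>\<^bsub>pr(j),pa(j)\<^esub> (\<Sigma>\<^bsub>pa(j)\<^esub>)\<^sup>-\<^sup>1 \<Sigma>\<^bsub>pa(j),j\<^esub>\<close> for every \<open>j\<close>. A \<open>p \<times> p\<close> matrix is represented
  by a function that vanishes outside \<open>verts p \<times> verts p\<close>, so that equality of functions
  is equality of matrices.
\<close>

definition PD :: "nat \<Rightarrow> (nat \<times> nat) set \<Rightarrow> matrix set" where
  "PD p E = {S. (\<forall>i j. \<not> (i \<in> verts p \<and> j \<in> verts p) \<longrightarrow> S i j = 0) \<and>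
     pos_def_on (verts p) S \<and>
     (\<forall>j\<in>verts p. \<forall>i\<in>pr p E j. S i j = regress (pa E j) S i j)}"


section \<open>Partial matrices and completions\<close>

type_synonym partial_matrix = "nat \<times> nat \<rightharpoonup> real"

text \<open>
  The zeros that replace undetermined entries only make the function total.
\<close>

definition matrix_of :: "partial_matrix \<Rightarrow> matrix" where
  "matrix_of G i j = (case G (i, j) of None \<Rightarrow> 0 | Some x \<Rightarrow> x)"

definition graph_partial_matrix :: "(nat \<times> nat) set \<Rightarrow> partial_matrix \<Rightarrow> bool" where
  "graph_partial_matrix E G \<longleftrightarrow> dom G = undirected E \<and> (\<forall>i j. G (i, j) = G (j, i))"

definition QD :: "nat \<Rightarrow> (nat \<times> nat) set \<Rightarrow> partial_matrix set" where
  "QD p E = {G. graph_partial_matrix E G \<and> (\<forall>C. clique p E C \<longrightarrow> pos_def_on C (matrix_of G))}"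

definition completions :: "nat \<Rightarrow> (nat \<times> nat) set \<Rightarrow> partial_matrix \<Rightarrow> matrix set" where
  "completions p E G = {T \<in> PD p E. \<forall>(i, j)\<in>E. G (i, j) = Some (T i j)}"


section \<open>The completion process\<close>

text \<open>
  A configuration records the step to be performed next, the current vertex and the entries
  determined so far; \<open>Completed\<close> and \<open>No_Completion\<close> are the two outcomes. Step (1) is the
  choice of the initial configuration.
\<close>

datatype stage = Step2 | Step3 | Step4 | Step5 | Completed | No_Completion

type_synonym config = "stage \<times> nat \<times> partial_matrix"

definition fill_column :: "nat \<Rightarrow> (nat \<times> nat) set \<Rightarrow> nat \<Rightarrow> (nat \<Rightarrow> real) \<Rightarrow> partial_matrix \<Rightarrow> partial_matrix"
  where
  "fill_column p E j v S = (\<lambda>(i, k).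
     if k = j \<and> i \<in> pr p E j then Some (v i)
     else if i = j \<and> k \<in> pr p E j then Some (v k)
     else S (i, k))"

fun process_step :: "nat \<Rightarrow> (nat \<times> nat) set \<Rightarrow> config \<Rightarrow> config" where
  "process_step p E (Step2, j, S) =
     (if 1 < j then (Step3, j - 1, S) else (Completed, j, S))"
| "process_step p E (Step3, j, S) =
     (if pos_def_on (fa E j) (matrix_of S) then (Step4, j, S) else (No_Completion, j, S))"
| "process_step p E (Step4, j, S) =
     (if pr p E j = {} then (Step2, j, S) else (Step5, j, S))"
| "process_step p E (Step5, j, S) =
     (if pa E j \<noteq> {}
      then (Step2, j, fill_column p E j (\<lambda>i. regress (pa E j) (matrix_of S) i j) S)
      else (Step2, j, fill_column p E j (\<lambda>i. 0) S))"
| "process_step p E (Completed, j, S) = (Completed, j, S)"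
| "process_step p E (No_Completion, j, S) = (No_Completion, j, S)"

definition process :: "nat \<Rightarrow> (nat \<times> nat) set \<Rightarrow> partial_matrix \<Rightarrow> nat \<Rightarrow> config" where
  "process p E G n = (process_step p E ^^ n) (Step2, p, G)"


section \<open>Algorithms over the reals and their complexity\<close>

text \<open>
  Algorithms are while programs on a real random access machine. The memory consists of index
  registers and of real cells \<open>cell s a i j\<close>, thought of as two-dimensional arrays \<open>a\<close>.
  Real cells are only accessible through exact arithmetic and order comparison; the only real
  constants are \<open>0\<close> and \<open>1\<close>; and real numbers cannot be converted to indices. The graph is
  accessible through the test \<open>Edge\<close>.

  The cost of an execution is the number of real arithmetic operations and of comparisons. All
  primitive tests count as comparisons, including those on indices and the edge queries, and a
  loop evaluates its guard in every round. Index arithmetic itself is free; it has no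
  multiplication.
\<close>

datatype iexp = IConst nat | IVar nat | IAdd iexp iexp | ISub iexp iexp

datatype rexp = RZero | ROne | Cell nat iexp iexp
  | RAdd rexp rexp | RSub rexp rexp | RMul rexp rexp | RDiv rexp rexp

datatype bexp = ILess iexp iexp | Edge iexp iexp | RLess rexp rexp
  | BNot bexp | BAnd bexp bexp

datatype com = Skip
  | IAssign nat iexp
  | RAssign nat iexp iexp rexp
  | Seq com com
  | If bexp com com
  | While bexp com

record state =
  ivar :: "nat \<Rightarrow> nat"
  cell :: "nat \<Rightarrow> nat \<Rightarrow> nat \<Rightarrow> real"

primrec ival :: "iexp \<Rightarrow> state \<Rightarrow> nat" where
  "ival (IConst n) s = n"
| "ival (IVar x) s = ivar s x"
| "ival (IAdd a b) s = ival a s + ival b s"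
| "ival (ISub a b) s = ival a s - ival b s"

primrec rval :: "rexp \<Rightarrow> state \<Rightarrow> real" where
  "rval RZero s = 0"
| "rval ROne s = 1"
| "rval (Cell a i j) s = cell s a (ival i s) (ival j s)"
| "rval (RAdd a b) s = rval a s + rval b s"
| "rval (RSub a b) s = rval a s - rval b s"
| "rval (RMul a b) s = rval a s * rval b s"
| "rval (RDiv a b) s = rval a s / rval b s"

text \<open>No division by zero occurs. An execution gets stuck at an expression that is not defined.\<close>

primrec rdefined :: "rexp \<Rightarrow> state \<Rightarrow> bool" where
  "rdefined RZero s = True"
| "rdefined ROne s = True"
| "rdefined (Cell a i j) s = True"
| "rdefined (RAdd a b) s = (rdefined a s \<and> rdefined b s)"
| "rdefined (RSub a b) s = (rdefined a s \<and> rdefined b s)"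
| "rdefined (RMul a b) s = (rdefined a s \<and> rdefined b s)"
| "rdefined (RDiv a b) s = (rdefined a s \<and> rdefined b s \<and> rval b s \<noteq> 0)"

primrec rcost :: "rexp \<Rightarrow> nat" where
  "rcost RZero = 0"
| "rcost ROne = 0"
| "rcost (Cell a i j) = 0"
| "rcost (RAdd a b) = rcost a + rcost b + 1"
| "rcost (RSub a b) = rcost a + rcost b + 1"
| "rcost (RMul a b) = rcost a + rcost b + 1"
| "rcost (RDiv a b) = rcost a + rcost b + 1"

primrec bval :: "(nat \<times> nat) set \<Rightarrow> bexp \<Rightarrow> state \<Rightarrow> bool" where
  "bval E (ILess a b) s = (ival a s < ival b s)"
| "bval E (Edge a b) s = ((ival a s, ival b s) \<in> E)"
| "bval E (RLess a b) s = (rval a s < rval b s)"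
| "bval E (BNot b) s = (\<not> bval E b s)"
| "bval E (BAnd b c) s = (bval E b s \<and> bval E c s)"

primrec bdefined :: "bexp \<Rightarrow> state \<Rightarrow> bool" where
  "bdefined (ILess a b) s = True"
| "bdefined (Edge a b) s = True"
| "bdefined (RLess a b) s = (rdefined a s \<and> rdefined b s)"
| "bdefined (BNot b) s = bdefined b s"
| "bdefined (BAnd b c) s = (bdefined b s \<and> bdefined c s)"

primrec bcost :: "bexp \<Rightarrow> nat" where
  "bcost (ILess a b) = 1"
| "bcost (Edge a b) = 1"
| "bcost (RLess a b) = rcost a + rcost b + 1"
| "bcost (BNot b) = bcost b"
| "bcost (BAnd b c) = bcost b + bcost c"

definition set_ivar :: "nat \<Rightarrow> nat \<Rightarrow> state \<Rightarrow> state" where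
  "set_ivar x n s = s\<lparr>ivar := (ivar s)(x := n)\<rparr>"

definition set_cell :: "nat \<Rightarrow> nat \<Rightarrow> nat \<Rightarrow> real \<Rightarrow> state \<Rightarrow> state" where
  "set_cell a i j r s =
     s\<lparr>cell := (cell s)(a := (cell s a)(i := (cell s a i)(j := r)))\<rparr>"

text \<open>
  \<open>exec E c s n t\<close>: on the graph \<open>E\<close>, the program \<open>c\<close> started in state \<open>s\<close> halts in state \<open>t\<close>
  and the execution costs \<open>n\<close>.
\<close>

inductive exec :: "(nat \<times> nat) set \<Rightarrow> com \<Rightarrow> state \<Rightarrow> nat \<Rightarrow> state \<Rightarrow> bool"
  for E :: "(nat \<times> nat) set" where
  Skip: "exec E Skip s 0 s"
| IAssign: "exec E (IAssign x e) s 0 (set_ivar x (ival e s) s)"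
| RAssign: "rdefined e s \<Longrightarrow>
    exec E (RAssign a i j e) s (rcost e) (set_cell a (ival i s) (ival j s) (rval e s) s)"
| Seq: "exec E c1 s m s' \<Longrightarrow> exec E c2 s' n t \<Longrightarrow> exec E (Seq c1 c2) s (m + n) t"
| IfTrue: "bdefined b s \<Longrightarrow> bval E b s \<Longrightarrow> exec E c1 s n t \<Longrightarrow>
    exec E (If b c1 c2) s (bcost b + n) t"
| IfFalse: "bdefined b s \<Longrightarrow> \<not> bval E b s \<Longrightarrow> exec E c2 s n t \<Longrightarrow>
    exec E (If b c1 c2) s (bcost b + n) t"
| WhileFalse: "bdefined b s \<Longrightarrow> \<not> bval E b s \<Longrightarrow> exec E (While b c) s (bcost b) s"
| WhileTrue: "bdefined b s \<Longrightarrow> bval E b s \<Longrightarrow> exec E c s m s' \<Longrightarrow>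
    exec E (While b c) s' n t \<Longrightarrow> exec E (While b c) s (bcost b + m + n) t"

inductive_cases exec_SkipE: "exec E Skip s n t"
inductive_cases exec_IAssignE: "exec E (IAssign x e) s n t"
inductive_cases exec_RAssignE: "exec E (RAssign a i j e) s n t"
inductive_cases exec_SeqE: "exec E (Seq c1 c2) s n t"
inductive_cases exec_IfE: "exec E (If b c1 c2) s n t"
inductive_cases exec_WhileE: "exec E (While b c) s n t"

text \<open>Programs are deterministic, so the existence of an execution says that the program halts.\<close>

lemma exec_deterministic:
  "exec E c s m t \<Longrightarrow> exec E c s n' u \<Longrightarrow> n' = m \<and> u = t"
proof (induction arbitrary: n' u rule: exec.induct)
  case (Skip s)
  from Skip.prems show ?case by (rule exec_SkipE) simp
next
  case (IAssign x e s)
  from IAssign.prems show ?case by (rule exec_IAssignE) simp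
next
  case (RAssign e s a i j)
  from RAssign.prems show ?case by (rule exec_RAssignE) simp
next
  case (Seq c1 s m s' c2 n t)
  from Seq.prems show ?case
  proof (rule exec_SeqE)
    fix m2 s2 n2
    assume *: "n' = m2 + n2" "exec E c1 s m2 s2" "exec E c2 s2 n2 u"
    from Seq.IH(1)[OF *(2)] have "m2 = m" "s2 = s'" by simp_all
    with Seq.IH(2)[of n2 u] * show ?thesis by simp
  qed
next
  case (IfTrue b s c1 n t c2)
  from IfTrue.prems show ?case
    by (rule exec_IfE) (use IfTrue.hyps IfTrue.IH in blast)+
next
  case (IfFalse b s c2 n t c1)
  from IfFalse.prems show ?case
    by (rule exec_IfE) (use IfFalse.hyps IfFalse.IH in blast)+
next
  case (WhileFalse b s c)
  from WhileFalse.prems show ?case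
    by (rule exec_WhileE) (use WhileFalse.hyps in simp_all)
next
  case (WhileTrue b s c m s' n t)
  from WhileTrue.prems show ?case
  proof (rule exec_WhileE)
    fix m2 s2 n2
    assume *: "n' = bcost b + m2 + n2" "exec E c s m2 s2" "exec E (While b c) s2 n2 u"
    from WhileTrue.IH(1)[OF *(2)] have "m2 = m" "s2 = s'" by simp_all
    with WhileTrue.IH(2)[of n2 u] * show ?thesis by simp
  qed (use WhileTrue.hyps in simp_all)
qed

text \<open>
  The input: \<open>p\<close> is in index register 0 and the partial matrix is in array 0, and everything else
  (in particular every cell of array 0 at an unspecified position) is \<open>0\<close>.
\<close>

definition input_state :: "nat \<Rightarrow> partial_matrix \<Rightarrow> state" where
  "input_state p G =
     \<lparr>ivar = (\<lambda>_. 0)(0 := p), cell = (\<lambda>_ _ _. 0)(0 := matrix_of G)\<rparr>"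

text \<open>
  The output: index register 1 holds \<open>1\<close> or \<open>0\<close> according to whether a completion exists, and if one
  exists, array 0 holds a completion.
\<close>

definition correct_output :: "nat \<Rightarrow> (nat \<times> nat) set \<Rightarrow> partial_matrix \<Rightarrow> state \<Rightarrow> bool" where
  "correct_output p E G t \<longleftrightarrow>
     ivar t 1 = (if completions p E G \<noteq> {} then 1 else 0) \<and>
     (completions p E G \<noteq> {} \<longrightarrow>
        (\<exists>T\<in>completions p E G. \<forall>i\<in>verts p. \<forall>j\<in>verts p. cell t 0 i j = T i j))"

end

theory Submission
  imports Defs
begin

text \<open>
  Work down from vertex \<open>p\<close>. If \<open>\<Sigma>\<close> is determined and positive definite on \<open>{j+1..p}\<close>, the Markov
  property at \<open>j\<close> forces the missing entries of column \<open>j\<close> to be \<open>\<Sigma>\<^bsub>pr(j),pa(j)\<^esub> \<beta>\<close>, where \<open>\<beta>\<close> solves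
  \<open>\<Sigma>\<^bsub>pa(j)\<^esub> \<beta> = \<Sigma>\<^bsub>pa(j),j\<^esub>\<close>; so all of column \<open>j\<close> below the diagonal is \<open>\<Sigma> \<beta>\<close>. Completing the square then
  shows that both \<open>\<Sigma>\<^bsub>fa(j)\<^esub>\<close> and \<open>\<Sigma>\<close> on \<open>{j..p}\<close> are positive definite iff the same Schur complement
  \<open>\<Sigma>\<^bsub>jj\<^esub> - \<Sigma>\<^bsub>j,pa(j)\<^esub> \<beta>\<close> is positive, while a completion must have \<open>\<Sigma>\<^bsub>fa(j)\<^esub>\<close> positive definite.

  For the complexity, eliminating the pivots \<open>pa(j)\<close> from \<open>\<Sigma>\<close>, with \<open>0\<close> in the undetermined places,
  gives \<open>\<Sigma> - \<Sigma>\<^bsub>V,pa(j)\<^esub> (\<Sigma>\<^bsub>pa(j)\<^esub>)\<^sup>-\<^sup>1 \<Sigma>\<^bsub>pa(j),V\<^esub>\<close>. Its entry at \<open>(j, j)\<close> is the Schur complement to be tested,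
  and its entries at \<open>(i, j)\<close> with \<open>i \<in> pr(j)\<close> are the negatives of those to be filled in. The pivots are
  positive, so no division by zero occurs.
\<close>

section \<open>Positive definite matrices\<close>

lemma pos_def_onD:
  assumes "pos_def_on A M"
  shows "i \<in> A \<Longrightarrow> j \<in> A \<Longrightarrow> M i j = M j i"
    and "i \<in> A \<Longrightarrow> x i \<noteq> 0 \<Longrightarrow> 0 < (\<Sum>i\<in>A. \<Sum>j\<in>A. x i * M i j * x j)"
  using assms unfolding pos_def_on_def by blast+

lemma pos_def_on_cong:
  assumes "\<And>i j. i \<in> A \<Longrightarrow> j \<in> A \<Longrightarrow> M i j = N i j"
  shows "pos_def_on A M \<longleftrightarrow> pos_def_on A N"
  unfolding pos_def_on_def using assms by (simp cong: sum.cong)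

lemma pos_def_on_subset:
  assumes "pos_def_on B M" "A \<subseteq> B" "finite B"
  shows "pos_def_on A M"
  unfolding pos_def_on_def
proof (intro conjI allI impI ballI)
  show "M i j = M j i" if "i \<in> A" "j \<in> A" for i j
    using that assms pos_def_onD(1)[OF assms(1)] by blast
next
  fix x :: "nat \<Rightarrow> real"
  assume "\<exists>i\<in>A. x i \<noteq> 0"
  then obtain i where i: "i \<in> A" "x i \<noteq> 0" by blast
  \<comment> \<open>Extension of \<open>x\<close> by zero: its form on \<open>B\<close> equals the
    form of \<open>x\<close> on \<open>A\<close>.\<close>
  define y where "y i = (if i \<in> A then x i else 0)" for i
  have "0 < (\<Sum>i\<in>B. \<Sum>j\<in>B. y i * M i j * y j)"
    using i assms by (intro pos_def_onD(2)[OF assms(1), of i]) (auto simp: y_def)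
  also have "\<dots> = (\<Sum>i\<in>A. \<Sum>j\<in>B. y i * M i j * y j)"
    using assms by (intro sum.mono_neutral_right) (auto simp: y_def)
  also have "\<dots> = (\<Sum>i\<in>A. \<Sum>j\<in>A. y i * M i j * y j)"
    using assms by (intro sum.cong refl sum.mono_neutral_right) (auto simp: y_def)
  also have "\<dots> = (\<Sum>i\<in>A. \<Sum>j\<in>A. x i * M i j * x j)"
    by (simp add: y_def)
  finally show "0 < (\<Sum>i\<in>A. \<Sum>j\<in>A. x i * M i j * x j)" .
qed

text \<open>
  Completing the square: with \<open>\<beta>\<close> solving \<open>M\<^bsub>A,A\<^esub> \<beta> = M\<^bsub>A,j\<^esub>\<close>, the form of a vector \<open>x\<close> on \<open>A \<union> {j}\<close>
  is the form of \<open>x + x\<^sub>j \<beta>\<close> on \<open>A\<close> plus \<open>x\<^sub>j\<^sup>2\<close> times the Schur complement.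
\<close>

lemma quadratic_form_insert:
  fixes M :: matrix
  assumes A: "finite A" "j \<notin> A"
    and sym: "\<And>i k. i \<in> insert j A \<Longrightarrow> k \<in> insert j A \<Longrightarrow> M i k = M k i"
    and \<beta>: "\<And>i. i \<in> A \<Longrightarrow> (\<Sum>k\<in>A. M i k * \<beta> k) = M i j"
  shows "(\<Sum>i\<in>insert j A. \<Sum>k\<in>insert j A. x i * M i k * x k) =
    (\<Sum>i\<in>A. \<Sum>k\<in>A. (x i + x j * \<beta> i) * M i k * (x k + x j * \<beta> k)) +
    (x j)\<^sup>2 * (M j j - (\<Sum>k\<in>A. M j k * \<beta> k))"
proof -
  have row: "(\<Sum>k\<in>A. c * M i k * \<beta> k) = c * M i j" if "i \<in> A" for i c
    using \<beta>[OF that] by (simp add: sum_distrib_left[symmetric] mult.assoc)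
  have swap: "(\<Sum>i\<in>A. \<Sum>k\<in>A. \<beta> i * M i k * x k) = (\<Sum>i\<in>A. x i * M i j)"
  proof -
    have "(\<Sum>i\<in>A. \<Sum>k\<in>A. \<beta> i * M i k * x k) = (\<Sum>k\<in>A. \<Sum>i\<in>A. \<beta> i * M i k * x k)"
      by (rule sum.swap)
    also have "\<dots> = (\<Sum>k\<in>A. \<Sum>i\<in>A. x k * M k i * \<beta> i)"
      by (intro sum.cong refl) (use sym in \<open>auto simp: mult_ac\<close>)
    finally show ?thesis using row by simp
  qed
  have "(\<Sum>i\<in>A. \<Sum>k\<in>A. (x i + x j * \<beta> i) * M i k * (x k + x j * \<beta> k)) =
    (\<Sum>i\<in>A. \<Sum>k\<in>A. x i * M i k * x k) + x j * (\<Sum>i\<in>A. \<Sum>k\<in>A. x i * M i k * \<beta> k)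
    + x j * (\<Sum>i\<in>A. \<Sum>k\<in>A. \<beta> i * M i k * x k) + (x j)\<^sup>2 * (\<Sum>i\<in>A. \<Sum>k\<in>A. \<beta> i * M i k * \<beta> k)"
    by (simp add: sum_distrib_left sum.distrib[symmetric] algebra_simps power2_eq_square)
  also have "\<dots> = (\<Sum>i\<in>A. \<Sum>k\<in>A. x i * M i k * x k) + 2 * x j * (\<Sum>i\<in>A. x i * M i j)
    + (x j)\<^sup>2 * (\<Sum>i\<in>A. \<beta> i * M i j)"
    by (simp add: swap row)
  finally have form: "(\<Sum>i\<in>A. \<Sum>k\<in>A. (x i + x j * \<beta> i) * M i k * (x k + x j * \<beta> k)) = \<dots>" .
  have eq1: "(\<Sum>k\<in>A. M j k * \<beta> k) = (\<Sum>i\<in>A. \<beta> i * M i j)"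
    by (intro sum.cong refl) (use sym in \<open>auto simp: mult_ac\<close>)
  have eq2: "(\<Sum>k\<in>A. x j * M j k * x k) = x j * (\<Sum>i\<in>A. x i * M i j)"
    unfolding sum_distrib_left by (intro sum.cong refl) (use sym in \<open>auto simp: mult_ac\<close>)
  have eq3: "(\<Sum>i\<in>A. x i * M i j * x j) = x j * (\<Sum>i\<in>A. x i * M i j)"
    unfolding sum_distrib_left by (intro sum.cong refl) (auto simp: mult_ac)
  have "(\<Sum>i\<in>insert j A. \<Sum>k\<in>insert j A. x i * M i k * x k) =
      x j * M j j * x j + (\<Sum>k\<in>A. x j * M j k * x k) +
      ((\<Sum>i\<in>A. x i * M i j * x j) + (\<Sum>i\<in>A. \<Sum>k\<in>A. x i * M i k * x k))"
    using A by (simp add: sum.distrib)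
  then show ?thesis
    unfolding form eq1 eq2 eq3 by (simp add: algebra_simps power2_eq_square)
qed

text \<open>In the completed square, \<open>x + x j * \<beta>\<close> on \<open>A\<close> and
  \<open>x j\<close> vary independently, so definiteness splits into definiteness on
  \<open>A\<close> and the sign of the Schur complement.\<close>

lemma pos_def_on_insert_iff:
  assumes A: "finite A" "j \<notin> A" and M: "pos_def_on A M"
    and sym: "\<And>i. i \<in> A \<Longrightarrow> M i j = M j i"
    and \<beta>: "\<And>i. i \<in> A \<Longrightarrow> (\<Sum>k\<in>A. M i k * \<beta> k) = M i j"
  shows "pos_def_on (insert j A) M \<longleftrightarrow> 0 < M j j - (\<Sum>k\<in>A. M j k * \<beta> k)" (is "_ \<longleftrightarrow> 0 < ?d")
proof -
  have symm: "M i k = M k i" if "i \<in> insert j A" "k \<in> insert j A" for i k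
    using that sym pos_def_onD(1)[OF M] by auto
  have form: "(\<Sum>i\<in>insert j A. \<Sum>k\<in>insert j A. x i * M i k * x k) =
    (\<Sum>i\<in>A. \<Sum>k\<in>A. (x i + x j * \<beta> i) * M i k * (x k + x j * \<beta> k)) + (x j)\<^sup>2 * ?d" for x
    using A symm \<beta> by (rule quadratic_form_insert)
  show ?thesis
  proof
    assume pd: "pos_def_on (insert j A) M"
    \<comment> \<open>This vector annihilates the square on \<open>A\<close>, so its form is the
      Schur complement itself.\<close>
    define x where "x i = (if i = j then 1 else - \<beta> i)" for i
    have "(\<Sum>i\<in>A. \<Sum>k\<in>A. (x i + x j * \<beta> i) * M i k * (x k + x j * \<beta> k)) = 0"
      using A by (intro sum.neutral ballI) (auto simp: x_def)
    moreover have "0 < (\<Sum>i\<in>insert j A. \<Sum>k\<in>insert j A. x i * M i k * x k)"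
      by (rule pos_def_onD(2)[OF pd, of j]) (simp_all add: x_def)
    ultimately have "0 < (x j)\<^sup>2 * ?d"
      unfolding form by simp
    then show "0 < ?d" by (simp add: x_def)
  next
    assume d: "0 < ?d"
    have "0 < (\<Sum>i\<in>insert j A. \<Sum>k\<in>insert j A. x i * M i k * x k)"
      if "\<exists>i\<in>insert j A. x i \<noteq> 0" for x
    proof (cases "\<exists>i\<in>A. x i + x j * \<beta> i \<noteq> 0")
      case True
      then have "0 < (\<Sum>i\<in>A. \<Sum>k\<in>A. (x i + x j * \<beta> i) * M i k * (x k + x j * \<beta> k))"
        using pos_def_onD(2)[OF M, of _ "\<lambda>i. x i + x j * \<beta> i"] by auto
      then show ?thesis
        unfolding form using d by (intro add_pos_nonneg) auto
    next
      case False
      then have zero: "(\<Sum>i\<in>A. \<Sum>k\<in>A. (x i + x j * \<beta> i) * M i k * (x k + x j * \<beta> k)) = 0"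
        by (intro sum.neutral ballI) auto
      \<comment> \<open>If \<open>x j\<close> vanished, \<open>False\<close> would make
        \<open>x\<close> vanish on \<open>A\<close> as well.\<close>
      have "x j \<noteq> 0" using False that by auto
      then show ?thesis
        unfolding form zero using d by simp
    qed
    then show "pos_def_on (insert j A) M"
      unfolding pos_def_on_def using symm by blast
  qed
qed

text \<open>
  The update of a solution when a further index becomes available: \<open>w\<close> and \<open>u\<close> solve the system on
  \<open>A\<close> for the column of the new index \<open>a\<close> and for the right hand side \<open>b\<close>.
\<close>

lemma solution_insert:
  fixes M :: matrix
  assumes A: "finite A" "a \<notin> A"
    and w: "\<And>i. i \<in> A \<Longrightarrow> (\<Sum>k\<in>A. M i k * w k) = M i a"
    and u: "\<And>i. i \<in> A \<Longrightarrow> (\<Sum>k\<in>A. M i k * u k) = b i"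
    and d: "M a a - (\<Sum>k\<in>A. M a k * w k) \<noteq> 0"
  obtains \<beta> where "\<And>i. i \<in> insert a A \<Longrightarrow> (\<Sum>k\<in>insert a A. M i k * \<beta> k) = b i"
    and "\<And>i. (\<Sum>k\<in>insert a A. M i k * \<beta> k) = (\<Sum>k\<in>A. M i k * u k) +
      (M i a - (\<Sum>k\<in>A. M i k * w k)) * (b a - (\<Sum>k\<in>A. M a k * u k)) /
      (M a a - (\<Sum>k\<in>A. M a k * w k))"
proof -
  \<comment> \<open>\<open>c\<close> is the coefficient at \<open>a\<close>, read off from row
    \<open>a\<close> after the rows of \<open>A\<close> have been eliminated; correcting
    \<open>u\<close> by \<open>- c * w\<close> keeps the equations on \<open>A\<close>
    valid.\<close>
  define c where "c = (b a - (\<Sum>k\<in>A. M a k * u k)) / (M a a - (\<Sum>k\<in>A. M a k * w k))"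
  define \<beta> where "\<beta> k = (if k = a then c else u k - c * w k)" for k
  have "(\<Sum>k\<in>A. M i k * \<beta> k) = (\<Sum>k\<in>A. M i k * u k - c * (M i k * w k))" for i
    using A by (intro sum.cong refl) (auto simp: \<beta>_def algebra_simps)
  then have eq: "(\<Sum>k\<in>insert a A. M i k * \<beta> k) =
      (\<Sum>k\<in>A. M i k * u k) + (M i a - (\<Sum>k\<in>A. M i k * w k)) * c" for i
    using A by (simp add: sum_subtractf sum_distrib_left[symmetric] algebra_simps \<beta>_def)
  have "(M a a - (\<Sum>k\<in>A. M a k * w k)) * c = b a - (\<Sum>k\<in>A. M a k * u k)"
    using d by (simp add: c_def)
  then have "(\<Sum>k\<in>insert a A. M i k * \<beta> k) = b i" if "i \<in> insert a A" for i
    using that unfolding eq by (auto simp: w u)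
  with eq show thesis
    by (intro that[of \<beta>]) (simp_all add: c_def)
qed

text \<open>Gaussian elimination as an induction: the pivot of a new index is its Schur complement,
  which is positive. The right hand side is kept general because the hypothesis is applied both to
  \<open>b\<close> and to the column of the new index.\<close>

lemma pos_def_on_solvable:
  assumes "finite A" "pos_def_on A M"
  shows "\<exists>\<beta>. \<forall>i\<in>A. (\<Sum>k\<in>A. M i k * \<beta> k) = b i"
  using assms
proof (induction A arbitrary: b rule: finite_induct)
  case (insert a A)
  have pd: "pos_def_on A M"
    using pos_def_on_subset[OF insert.prems] insert.hyps by blast
  obtain w where w: "\<And>i. i \<in> A \<Longrightarrow> (\<Sum>k\<in>A. M i k * w k) = M i a"
    using insert.IH[OF pd, of "\<lambda>i. M i a"] by blast
  obtain u where u: "\<And>i. i \<in> A \<Longrightarrow> (\<Sum>k\<in>A. M i k * u k) = b i"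
    using insert.IH[OF pd, of b] by blast
  have "M i a = M a i" if "i \<in> A" for i
    using pos_def_onD(1)[OF insert.prems] that by blast
  from pos_def_on_insert_iff[OF insert.hyps pd this w]
  have "M a a - (\<Sum>k\<in>A. M a k * w k) \<noteq> 0" using insert.prems by simp
  from insert.hyps w u this show ?case
    by (rule solution_insert) blast+
qed simp

text \<open>Shows that the definite description in \<open>inverse_on\<close> is proper. Solving for
  unit vectors gives a right inverse, symmetry of \<open>M\<close> makes its transpose a left
  inverse, and a left inverse agrees with every right inverse.\<close>

lemma pos_def_on_inverse:
  assumes A: "finite A" and M: "pos_def_on A M"
  shows "i \<in> A \<Longrightarrow> j \<in> A \<Longrightarrow> (\<Sum>k\<in>A. inverse_on A M i k * M k j) = (if i = j then 1 else 0)"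
proof -
  let ?P = "\<lambda>B. (\<forall>i j. \<not> (i \<in> A \<and> j \<in> A) \<longrightarrow> B i j = 0) \<and>
     (\<forall>i\<in>A. \<forall>j\<in>A. (\<Sum>k\<in>A. M i k * B k j) = (if i = j then 1 else 0)) \<and>
     (\<forall>i\<in>A. \<forall>j\<in>A. (\<Sum>k\<in>A. B i k * M k j) = (if i = j then 1 else 0))"
  have unique: "L i j = R i j"
    if L: "\<And>i j. i \<in> A \<Longrightarrow> j \<in> A \<Longrightarrow> (\<Sum>k\<in>A. L i k * M k j) = (if i = j then 1 else 0)"
      and R: "\<And>i j. i \<in> A \<Longrightarrow> j \<in> A \<Longrightarrow> (\<Sum>k\<in>A. M i k * R k j) = (if i = j then 1 else 0)"
      and ij: "i \<in> A" "j \<in> A" for L R :: matrix and i j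
  proof -
    have "L i j = (\<Sum>k\<in>A. L i k * (if k = j then 1 else 0))"
      using A ij by (simp add: if_distrib cong: if_cong)
    also have "\<dots> = (\<Sum>k\<in>A. L i k * (\<Sum>l\<in>A. M k l * R l j))"
      using R ij by (simp cong: sum.cong)
    also have "\<dots> = (\<Sum>l\<in>A. (\<Sum>k\<in>A. L i k * M k l) * R l j)"
      unfolding sum_distrib_left sum_distrib_right by (subst sum.swap) (simp add: mult_ac)
    also have "\<dots> = (\<Sum>l\<in>A. (if i = l then 1 else 0) * R l j)"
      using L ij by (simp cong: sum.cong)
    also have "\<dots> = R i j"
      using A ij by (simp add: if_distrib[of "\<lambda>x. x * _"] cong: if_cong)
    finally show ?thesis .
  qed
  have "\<exists>\<beta>. \<forall>i\<in>A. (\<Sum>k\<in>A. M i k * \<beta> k) = (if i = j then 1 else 0 :: real)" for j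
    using A M by (rule pos_def_on_solvable)
  then obtain R where R: "\<And>i j. i \<in> A \<Longrightarrow> (\<Sum>k\<in>A. M i k * R j k) = (if i = j then 1 else 0 :: real)"
    by metis
  define B where "B k j = (if k \<in> A \<and> j \<in> A then R j k else 0)" for k j
  have right: "(\<Sum>k\<in>A. M i k * B k j) = (if i = j then 1 else 0)" if "i \<in> A" "j \<in> A" for i j
    using R[OF that(1), of j] that by (simp add: B_def cong: sum.cong)
  have left: "(\<Sum>k\<in>A. B k i * M k j) = (if i = j then 1 else 0)" if "i \<in> A" "j \<in> A" for i j
  proof -
    have "(\<Sum>k\<in>A. B k i * M k j) = (\<Sum>k\<in>A. M j k * B k i)"
      by (intro sum.cong refl) (use that pos_def_onD(1)[OF M] in auto)
    then show ?thesis using right that by auto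
  qed
  \<comment> \<open>The transpose of \<open>B\<close> is a left inverse and \<open>B\<close> a right
    one, so they coincide.\<close>
  have "B k i = B i k" if "i \<in> A" "k \<in> A" for i k
    using unique[of "\<lambda>i k. B k i" B, OF left right] that by blast
  then have left': "(\<Sum>k\<in>A. B i k * M k j) = (if i = j then 1 else 0)" if "i \<in> A" "j \<in> A" for i j
    using left[OF that] that by (simp cong: sum.cong)
  have "?P B"
    using right left' by (simp add: B_def)
  moreover have "B' = B" if "?P B'" for B'
  proof (intro ext)
    fix i j
    show "B' i j = B i j"
    proof (cases "i \<in> A \<and> j \<in> A")
      case True
      show ?thesis
        by (rule unique[of B' B]) (use that True right in blast)+
    next
      case False
      then have "B' i j = 0" "B i j = 0" using that by (blast, auto simp: B_def)
      then show ?thesis by simp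
    qed
  qed
  ultimately have "?P (inverse_on A M)"
    unfolding inverse_on_def by (rule theI)
  then show "i \<in> A \<Longrightarrow> j \<in> A \<Longrightarrow> (\<Sum>k\<in>A. inverse_on A M i k * M k j) = (if i = j then 1 else 0)"
    by blast
qed


section \<open>Regression\<close>

lemma regress_empty [simp]: "regress {} M i j = 0"
  by (simp add: regress_def)

lemma inverse_on_cong:
  assumes "\<And>i j. i \<in> A \<Longrightarrow> j \<in> A \<Longrightarrow> M i j = N i j"
  shows "inverse_on A M = inverse_on A N"
  unfolding inverse_on_def using assms by (simp cong: sum.cong)

text \<open>Transfers regressions between matrices that agree on the blocks read: before and after a
  filling, or between the process and a completion.\<close>

lemma regress_cong:
  assumes "\<And>k l. k \<in> A \<Longrightarrow> l \<in> A \<Longrightarrow> M k l = N k l"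
    and "\<And>k. k \<in> A \<Longrightarrow> M i k = N i k" "\<And>k. k \<in> A \<Longrightarrow> M k j = N k j"
  shows "regress A M i j = regress A N i j"
proof -
  have "inverse_on A M = inverse_on A N"
    using assms(1) by (rule inverse_on_cong)
  then show ?thesis
    unfolding regress_def by (intro sum.cong refl) (simp_all add: assms)
qed

text \<open>Applying the inverse to the linear system returns \<beta>; from here on such a solution
  takes the place of the inverse.\<close>

lemma regress_eq:
  assumes A: "finite A" and M: "pos_def_on A M"
    and \<beta>: "\<And>k. k \<in> A \<Longrightarrow> (\<Sum>l\<in>A. M k l * \<beta> l) = M k j"
  shows "regress A M i j = (\<Sum>k\<in>A. M i k * \<beta> k)"
proof -
  have "(\<Sum>l\<in>A. inverse_on A M k l * M l j) = \<beta> k" if k: "k \<in> A" for k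
  proof -
    have "(\<Sum>l\<in>A. inverse_on A M k l * M l j) =
        (\<Sum>l\<in>A. inverse_on A M k l * (\<Sum>m\<in>A. M l m * \<beta> m))"
      by (simp add: \<beta> cong: sum.cong)
    also have "\<dots> = (\<Sum>m\<in>A. (\<Sum>l\<in>A. inverse_on A M k l * M l m) * \<beta> m)"
      unfolding sum_distrib_left sum_distrib_right by (subst sum.swap) (simp add: mult_ac)
    also have "\<dots> = (\<Sum>m\<in>A. (if k = m then 1 else 0) * \<beta> m)"
      using pos_def_on_inverse[OF A M k] by (simp cong: sum.cong)
    also have "\<dots> = \<beta> k"
      using A k by (simp add: if_distrib[of "\<lambda>x. x * _"] cong: if_cong)
    finally show ?thesis .
  qed
  then show ?thesis
    unfolding regress_def by (simp add: mult.assoc sum_distrib_left[symmetric] cong: sum.cong)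
qed

lemma regress_solution:
  assumes "finite A" "pos_def_on A M"
  obtains \<beta> where "\<And>i. i \<in> A \<Longrightarrow> (\<Sum>k\<in>A. M i k * \<beta> k) = M i j"
    and "\<And>i. regress A M i j = (\<Sum>k\<in>A. M i k * \<beta> k)"
  using pos_def_on_solvable[OF assms, of "\<lambda>i. M i j"] regress_eq[OF assms, of _ j] by metis

lemma pos_def_on_insert_iff_regress:
  assumes "finite A" "j \<notin> A" "pos_def_on A M" "\<And>i. i \<in> A \<Longrightarrow> M i j = M j i"
  shows "pos_def_on (insert j A) M \<longleftrightarrow> 0 < M j j - regress A M j j"
proof -
  obtain \<beta> where "\<And>i. i \<in> A \<Longrightarrow> (\<Sum>k\<in>A. M i k * \<beta> k) = M i j"
    and "\<And>i. regress A M i j = (\<Sum>k\<in>A. M i k * \<beta> k)"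
    using regress_solution[OF assms(1,3)] by metis
  then show ?thesis
    using pos_def_on_insert_iff[OF assms, of \<beta>] by simp
qed

text \<open>Extended by zero, the solution on \<open>A\<close> also solves the system on
  \<open>W\<close>, since the rows in \<open>W - A\<close> are exactly the regression equations. So
  \<open>insert j A\<close> and \<open>insert j W\<close> share one Schur complement.\<close>

lemma pos_def_on_insert_regress:
  assumes W: "finite W" "A \<subseteq> W" "j \<notin> W" and M: "pos_def_on W M"
    and fa: "pos_def_on (insert j A) M"
    and sym: "\<And>i. i \<in> W \<Longrightarrow> M i j = M j i"
    and regress: "\<And>i. i \<in> W - A \<Longrightarrow> M i j = regress A M i j"
  shows "pos_def_on (insert j W) M"
proof -
  have A: "finite A" "j \<notin> A" and pd: "pos_def_on A M"
    using W finite_subset pos_def_on_subset[OF M] by auto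
  obtain \<beta> where \<beta>: "\<And>i. i \<in> A \<Longrightarrow> (\<Sum>k\<in>A. M i k * \<beta> k) = M i j"
    and r: "\<And>i. regress A M i j = (\<Sum>k\<in>A. M i k * \<beta> k)"
    using regress_solution[OF A(1) pd] by metis
  have A_sym: "M i j = M j i" if "i \<in> A" for i
    using sym W that by blast
  define \<gamma> where "\<gamma> k = (if k \<in> A then \<beta> k else 0)" for k
  have \<gamma>: "(\<Sum>k\<in>W. M i k * \<gamma> k) = (\<Sum>k\<in>A. M i k * \<beta> k)" for i
  proof -
    have "(\<Sum>k\<in>W. M i k * \<gamma> k) = (\<Sum>k\<in>A. M i k * \<gamma> k)"
      using W by (intro sum.mono_neutral_right) (auto simp: \<gamma>_def)
    then show ?thesis by (simp add: \<gamma>_def)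
  qed
  have "(\<Sum>k\<in>W. M i k * \<gamma> k) = M i j" if "i \<in> W" for i
    unfolding \<gamma> using \<beta> r regress[of i] that by (cases "i \<in> A") auto
  from pos_def_on_insert_iff[OF W(1,3) M sym this]
  show ?thesis
    unfolding \<gamma> using fa pos_def_on_insert_iff[OF A pd A_sym \<beta>] by blast
qed

text \<open>The residual \<open>M i j - regress A M i j\<close> changes by the rank one term of an
  elimination step with pivot \<open>a\<close>, and that pivot is positive. This is what
  \<open>Eliminate\<close> computes and why its division is defined.\<close>

lemma regress_insert:
  assumes A: "finite A" "a \<notin> A" and pd: "pos_def_on (insert a A) M"
  shows "0 < M a a - regress A M a a"
    and "regress (insert a A) M i j = regress A M i j +
      (M i a - regress A M i a) * (M a j - regress A M a j) / (M a a - regress A M a a)"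
proof -
  have M: "pos_def_on A M"
    using pos_def_on_subset[OF pd] A by blast
  have "M i a = M a i" if "i \<in> A" for i
    using pos_def_onD(1)[OF pd] that by blast
  then show pos: "0 < M a a - regress A M a a"
    using pos_def_on_insert_iff_regress[OF A M] pd by blast
  obtain w where w: "\<And>i. i \<in> A \<Longrightarrow> (\<Sum>k\<in>A. M i k * w k) = M i a"
    and rw: "\<And>i. regress A M i a = (\<Sum>k\<in>A. M i k * w k)"
    using regress_solution[OF A(1) M] by metis
  obtain u where u: "\<And>i. i \<in> A \<Longrightarrow> (\<Sum>k\<in>A. M i k * u k) = M i j"
    and ru: "\<And>i. regress A M i j = (\<Sum>k\<in>A. M i k * u k)"
    using regress_solution[OF A(1) M] by metis
  have d: "M a a - (\<Sum>k\<in>A. M a k * w k) \<noteq> 0"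
    using pos rw by simp
  obtain \<beta> where \<beta>: "\<And>i. i \<in> insert a A \<Longrightarrow> (\<Sum>k\<in>insert a A. M i k * \<beta> k) = M i j"
    and r: "\<And>i. (\<Sum>k\<in>insert a A. M i k * \<beta> k) = (\<Sum>k\<in>A. M i k * u k) +
      (M i a - (\<Sum>k\<in>A. M i k * w k)) * (M a j - (\<Sum>k\<in>A. M a k * u k)) /
      (M a a - (\<Sum>k\<in>A. M a k * w k))"
    using A w u d by (rule solution_insert[where b = "\<lambda>i. M i j"]) blast+
  show "regress (insert a A) M i j = regress A M i j +
      (M i a - regress A M i a) * (M a j - regress A M a j) / (M a a - regress A M a a)"
    using regress_eq[OF _ pd \<beta>, of i] A(1) by (simp only: finite_insert r rw ru)
qed

section \<open>The completion process\<close>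

lemma matrix_of_Some: "S (i, j) = Some x \<Longrightarrow> matrix_of S i j = x"
  by (simp add: matrix_of_def)

lemma matrix_of_outside: "(i, j) \<notin> dom S \<Longrightarrow> matrix_of S i j = 0"
  by (auto simp: matrix_of_def split: option.split)

lemma matrix_of_inside: "(i, j) \<in> dom S \<Longrightarrow> S (i, j) = Some (matrix_of S i j)"
  by (auto simp: matrix_of_def)

lemma matrix_of_fill_column:
  "matrix_of (fill_column p E j v S) i k =
    (if k = j \<and> i \<in> pr p E j then v i
     else if i = j \<and> k \<in> pr p E j then v k else matrix_of S i k)"
  by (auto simp: matrix_of_def fill_column_def)

text \<open>Unifies the branches of a round: without parents the regression is zero, and with
  \<open>pr p E j\<close> empty nothing changes.\<close>

definition fill_regress ::
    "nat \<Rightarrow> (nat \<times> nat) set \<Rightarrow> nat \<Rightarrow> partial_matrix \<Rightarrow> partial_matrix" where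
  "fill_regress p E j S = fill_column p E j (\<lambda>i. regress (pa E j) (matrix_of S) i j) S"

section \<open>The graph and the given entries\<close>

locale dag_partial_matrix =
  fixes p :: nat and E :: "(nat \<times> nat) set" and G :: partial_matrix
  assumes dag: "dag p E" and G: "G \<in> QD p E"
begin

lemma
  shows edge_verts: "(i, k) \<in> E \<Longrightarrow> i \<in> verts p \<and> k \<in> verts p"
    and loop: "i \<in> verts p \<Longrightarrow> (i, i) \<in> E"
    and edge_less: "(i, k) \<in> E \<Longrightarrow> i \<noteq> k \<Longrightarrow> k < i"
    and p_pos: "1 \<le> p"
  using dag unfolding dag_def by auto

lemma undirected_verts: "(i, k) \<in> undirected E \<Longrightarrow> i \<in> verts p \<and> k \<in> verts p"
  by (auto simp: undirected_def dest: edge_verts)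

lemma G_dom: "dom G = undirected E" and G_sym: "G (i, k) = G (k, i)"
  using G by (simp_all add: QD_def graph_partial_matrix_def)

lemma pa_subset: "pa E j \<subseteq> {Suc j..p}"
proof
  fix i assume "i \<in> pa E j"
  then have "(i, j) \<in> E" "i \<noteq> j" by (simp_all add: pa_def)
  then show "i \<in> {Suc j..p}"
    using edge_verts[of i j] edge_less[of i j] by (simp add: verts_def)
qed

lemma finite_pa: "finite (pa E j)"
  using pa_subset finite_subset by blast

lemma pr_subset: "pr p E j \<subseteq> {Suc j..p}"
  by (auto simp: pr_def verts_def)

text \<open>Edges descend, so the only possible edge between \<open>j\<close> and a larger
  \<open>i\<close> would make \<open>i\<close> a parent. Hence filling never overwrites a given
  entry.\<close>

lemma pr_not_adjacent:
  assumes "i \<in> pr p E j"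
  shows "(i, j) \<notin> undirected E" "(j, i) \<notin> undirected E"
  using assms edge_less[of j i] by (auto simp: pr_def pa_def undirected_def)

lemma pa_Un_pr: "j \<in> verts p \<Longrightarrow> pa E j \<union> pr p E j = {Suc j..p}"
  using pa_subset by (auto simp: pr_def verts_def)

text \<open>\<open>QD\<close> constrains maximal sets only; by finiteness a vertex extends to a
  clique, and its singleton inherits definiteness.\<close>

lemma G_diagonal_pos:
  assumes i: "i \<in> verts p"
  shows "0 < matrix_of G i i"
proof -
  let ?\<C> = "{C. pairwise_adjacent p E C \<and> i \<in> C}"
  have "?\<C> \<subseteq> Pow (verts p)"
    by (auto simp: pairwise_adjacent_def)
  then have "finite ?\<C>"
    by (rule finite_subset) (simp add: verts_def)
  moreover have "{i} \<in> ?\<C>"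
    using i by (simp add: pairwise_adjacent_def)
  ultimately obtain C where C: "C \<in> ?\<C>" and max: "\<And>C'. C' \<in> ?\<C> \<Longrightarrow> C \<subseteq> C' \<Longrightarrow> C = C'"
    using finite_has_maximal[of ?\<C>] by blast
  have "clique p E C"
    unfolding clique_def using C max by blast
  then have pd: "pos_def_on C (matrix_of G)"
    using G by (simp add: QD_def)
  have "finite C"
    using C finite_subset[of C "verts p"] by (auto simp: pairwise_adjacent_def verts_def)
  then have "pos_def_on {i} (matrix_of G)"
    using pos_def_on_subset[OF pd] C by blast
  from pos_def_onD(2)[OF this, of i "\<lambda>_. 1"] show ?thesis by simp
qed

text \<open>
  The invariant of the process: the entries with both indices in \<open>{j..p}\<close> have been determined, and
  the choice was forced.
\<close>

definition completed_from :: "nat \<Rightarrow> partial_matrix \<Rightarrow> bool" where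
  "completed_from j S \<longleftrightarrow> 1 \<le> j \<and> j \<le> p \<and>
     dom S = undirected E \<union> {j..p} \<times> {j..p} \<and>
     (\<forall>i k. S (i, k) = S (k, i)) \<and>
     (\<forall>e\<in>undirected E. S e = G e) \<and>
     pos_def_on {j..p} (matrix_of S) \<and>
     (\<forall>k\<in>{j..p}. \<forall>i\<in>pr p E k. matrix_of S i k = regress (pa E k) (matrix_of S) i k) \<and>
     (\<forall>T\<in>completions p E G. \<forall>(i, k)\<in>dom S. S (i, k) = Some (T i k))"

lemma completed_fromD:
  assumes "completed_from j S"
  shows "1 \<le> j" "j \<le> p" "dom S = undirected E \<union> {j..p} \<times> {j..p}"
    and "S (i, k) = S (k, i)"
    and "e \<in> undirected E \<Longrightarrow> S e = G e"
    and "pos_def_on {j..p} (matrix_of S)"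
    and "k \<in> {j..p} \<Longrightarrow> i \<in> pr p E k \<Longrightarrow>
      matrix_of S i k = regress (pa E k) (matrix_of S) i k"
    and "T \<in> completions p E G \<Longrightarrow> (i, k) \<in> dom S \<Longrightarrow> matrix_of S i k = T i k"
proof -
  note S = assms[unfolded completed_from_def]
  show "1 \<le> j" "j \<le> p" "dom S = undirected E \<union> {j..p} \<times> {j..p}" "S (i, k) = S (k, i)"
    "pos_def_on {j..p} (matrix_of S)"
    using S by simp_all
  show "S e = G e" if "e \<in> undirected E"
    using S that by simp
  show "matrix_of S i k = regress (pa E k) (matrix_of S) i k"
    if "k \<in> {j..p}" "i \<in> pr p E k"
    using S that by simp
  show "matrix_of S i k = T i k" if "T \<in> completions p E G" "(i, k) \<in> dom S"
  proof -
    have "\<forall>(i, k)\<in>dom S. S (i, k) = Some (T i k)"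
      using S that(1) by simp
    then have "S (i, k) = Some (T i k)" using that(2) by blast
    then show ?thesis by (rule matrix_of_Some)
  qed
qed

lemma completionD:
  assumes "T \<in> completions p E G"
  shows "pos_def_on (verts p) T" "(i, k) \<in> undirected E \<Longrightarrow> G (i, k) = Some (T i k)"
    and "\<not> (i \<in> verts p \<and> k \<in> verts p) \<Longrightarrow> T i k = 0"
    and "j \<in> verts p \<Longrightarrow> i \<in> pr p E j \<Longrightarrow> T i j = regress (pa E j) T i j"
proof -
  show pd: "pos_def_on (verts p) T"
    and "\<not> (i \<in> verts p \<and> k \<in> verts p) \<Longrightarrow> T i k = 0"
    and "j \<in> verts p \<Longrightarrow> i \<in> pr p E j \<Longrightarrow> T i j = regress (pa E j) T i j"
    using assms unfolding completions_def PD_def by blast+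
  have edge: "G (i, k) = Some (T i k)" if "(i, k) \<in> E" for i k
    using assms that unfolding completions_def by blast
  \<comment> \<open>Agreement is required on directed edges; the symmetry of \<open>T\<close> and
    \<open>G\<close> carries it to reversed ones.\<close>
  show "G (i, k) = Some (T i k)" if ik: "(i, k) \<in> undirected E"
  proof (cases "(i, k) \<in> E")
    case False
    then have "(k, i) \<in> E" using ik by (simp add: undirected_def)
    moreover have "T k i = T i k"
      using pos_def_onD(1)[OF pd] undirected_verts[OF ik] by blast
    ultimately show ?thesis using edge[of k i] G_sym[of i k] by simp
  qed (rule edge)
qed

lemma completed_from_initial: "completed_from p G"
proof -
  have p: "p \<in> verts p" using p_pos by (simp add: verts_def)
  have pos: "0 < matrix_of G p p"
    using G_diagonal_pos[OF p] .
  have "pos_def_on {p} (matrix_of G)"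
    unfolding pos_def_on_def
  proof (intro conjI allI impI)
    fix x :: "nat \<Rightarrow> real"
    assume "\<exists>i\<in>{p}. x i \<noteq> 0"
    then have "0 < matrix_of G p p * (x p)\<^sup>2" using pos by simp
    then show "0 < (\<Sum>i\<in>{p}. \<Sum>j\<in>{p}. x i * matrix_of G i j * x j)"
      by (simp add: power2_eq_square mult_ac)
  qed simp
  moreover have "pr p E p = {}" using pr_subset[of p] by simp
  moreover have "dom G = undirected E \<union> {p} \<times> {p}"
    using G_dom loop[OF p] by (auto simp: undirected_def)
  ultimately show ?thesis
    unfolding completed_from_def using p_pos G_sym G_dom completionD(2) by auto
qed

section \<open>One round: from the vertices above \<open>j\<close> to those from \<open>j\<close>
  on\<close>

context
  fixes j :: nat and S :: partial_matrix
  assumes S: "completed_from (Suc j) S" and j: "1 \<le> j"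
begin

lemma j_in_verts: "j \<in> verts p"
  using completed_fromD(2)[OF S] j by (simp add: verts_def)

lemma S_sym: "matrix_of S i k = matrix_of S k i"
  by (simp add: matrix_of_def completed_fromD(4)[OF S, of i k])

text \<open>Step (3) is meaningful: entries involving \<open>j\<close> are edges or the loop, and
  entries among parents lie in the finished block.\<close>

lemma fa_subset_dom: "fa E j \<times> fa E j \<subseteq> dom S"
proof -
  have "(j, j) \<in> undirected E" using loop[OF j_in_verts] by (simp add: undirected_def)
  moreover have "(i, j) \<in> undirected E" "(j, i) \<in> undirected E" if "i \<in> pa E j" for i
    using that by (auto simp: pa_def undirected_def)
  moreover have "pa E j \<times> pa E j \<subseteq> {Suc j..p} \<times> {Suc j..p}"
    using pa_subset by blast
  ultimately show ?thesis
    unfolding completed_fromD(3)[OF S] fa_def by blast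
qed

lemma pr_pa_subset_dom: "pr p E j \<times> pa E j \<subseteq> dom S"
  unfolding completed_fromD(3)[OF S] using pr_subset pa_subset by blast

text \<open>These entries are therefore \<open>0\<close> in \<open>matrix_of S\<close>, so the
  residual there is minus the regression.\<close>

lemma pr_not_dom: "i \<in> pr p E j \<Longrightarrow> (i, j) \<notin> dom S"
  unfolding completed_fromD(3)[OF S] using pr_not_adjacent by auto

lemma pos_def_on_pa: "pos_def_on (pa E j) (matrix_of S)"
  using pos_def_on_subset[OF completed_fromD(6)[OF S] pa_subset] by simp

text \<open>Reduces the test of step (3) to one sign comparison, the form in which the program
  performs it.\<close>

lemma fa_pos_def_iff:
  "pos_def_on (fa E j) (matrix_of S) \<longleftrightarrow>
    0 < matrix_of S j j - regress (pa E j) (matrix_of S) j j"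
  using pos_def_on_insert_iff_regress[OF finite_pa _ pos_def_on_pa S_sym, of j]
  by (simp add: fa_def pa_def)

text \<open>A completion agrees with the forced entries of \<open>S\<close>, and its principal
  submatrices are positive definite; so failing step (3) excludes a completion.\<close>

lemma completion_imp_fa_pos_def:
  assumes T: "T \<in> completions p E G"
  shows "pos_def_on (fa E j) (matrix_of S)"
proof -
  have "fa E j \<subseteq> verts p"
    using pa_subset[of j] j_in_verts by (auto simp: fa_def verts_def)
  then have "pos_def_on (fa E j) T"
    using pos_def_on_subset[OF completionD(1)[OF T]] by (simp add: verts_def)
  moreover have "matrix_of S i k = T i k" if "i \<in> fa E j" "k \<in> fa E j" for i k
    using completed_fromD(8)[OF S T] fa_subset_dom that by blast
  ultimately show ?thesis
    using pos_def_on_cong by blast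
qed

lemma completed_from_fill:
  assumes fa: "pos_def_on (fa E j) (matrix_of S)"
  shows "completed_from j (fill_regress p E j S)"
proof -
  let ?M = "matrix_of S" and ?S' = "fill_regress p E j S"
  let ?M' = "matrix_of ?S'"
  have M': "?M' i k = (if k = j \<and> i \<in> pr p E j then regress (pa E j) ?M i j
     else if i = j \<and> k \<in> pr p E j then regress (pa E j) ?M k j else ?M i k)" for i k
    unfolding fill_regress_def by (rule matrix_of_fill_column)
  have j_notin_pr: "j \<notin> pr p E j" and pa_notin_pr: "i \<in> pa E j \<Longrightarrow> i \<notin> pr p E j" for i
    using pr_subset by (auto simp: pr_def)
  have above: "?M' i k = ?M i k" if "i \<in> {Suc j..p}" "k \<in> {Suc j..p}" for i k
    using that by (simp add: M')
  \<comment> \<open>A regression at \<open>k\<close> reads entries above \<open>j\<close> or, for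
    \<open>k = j\<close>, entries of parents in column \<open>j\<close>; the filling changes
    neither.\<close>
  have regress_above: "regress (pa E k) ?M' i k = regress (pa E k) ?M i k"
    if "k \<in> {j..p}" "i \<in> pr p E k" for i k
  proof (rule regress_cong)
    show "?M' l m = ?M l m" if "l \<in> pa E k" "m \<in> pa E k" for l m
      using that \<open>k \<in> {j..p}\<close> pa_subset[of k] by (intro above) auto
    show "?M' i l = ?M i l" if "l \<in> pa E k" for l
      using that \<open>k \<in> {j..p}\<close> \<open>i \<in> pr p E k\<close> pa_subset[of k] pr_subset[of k]
      by (intro above) auto
    show "?M' l k = ?M l k" if "l \<in> pa E k" for l
    proof (cases "k = j")
      case True
      then show ?thesis using that pa_notin_pr pa_subset[of j] by (auto simp: M')
    next
      case False
      then show ?thesis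
        using that \<open>k \<in> {j..p}\<close> pa_subset[of k] by (intro above) auto
    qed
  qed
  have dom: "dom ?S' = undirected E \<union> {j..p} \<times> {j..p}"
  proof -
    have "dom ?S' = dom S \<union> pr p E j \<times> {j} \<union> {j} \<times> pr p E j"
      by (auto simp: fill_regress_def fill_column_def split: if_splits)
    also have "\<dots> = undirected E \<union> ({Suc j..p} \<times> {Suc j..p} \<union> pr p E j \<times> {j} \<union> {j} \<times> pr p E j)"
      unfolding completed_fromD(3)[OF S] by blast
    \<comment> \<open>The parent entries and the diagonal entry added here are edges, so the union
      stays the same.\<close>
    also have "\<dots> = undirected E \<union> ({Suc j..p} \<times> {Suc j..p} \<union>
        (pa E j \<union> pr p E j) \<times> {j} \<union> {j} \<times> (pa E j \<union> pr p E j) \<union> {j} \<times> {j})"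
      using loop[OF j_in_verts] by (auto simp: pa_def undirected_def)
    also have "\<dots> = undirected E \<union> {j..p} \<times> {j..p}"
      unfolding pa_Un_pr[OF j_in_verts] using completed_fromD(2)[OF S] by auto
    finally show ?thesis .
  qed
  have sym: "?S' (i, k) = ?S' (k, i)" for i k
    using j_notin_pr completed_fromD(4)[OF S, of i k]
    by (auto simp: fill_regress_def fill_column_def)
  have old: "?S' e = G e" if "e \<in> undirected E" for e
    using that pr_not_adjacent completed_fromD(5)[OF S that]
    by (cases e) (auto simp: fill_regress_def fill_column_def)
  have pd: "pos_def_on {j..p} ?M'"
  proof -
    have "pos_def_on (insert j {Suc j..p}) ?M'"
    proof (rule pos_def_on_insert_regress)
      show "pos_def_on {Suc j..p} ?M'"
        using completed_fromD(6)[OF S] pos_def_on_cong above by blast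
      have "?M' i k = ?M i k" if "i \<in> insert j (pa E j)" "k \<in> insert j (pa E j)" for i k
        using that pa_notin_pr j_notin_pr by (auto simp: M')
      then show "pos_def_on (insert j (pa E j)) ?M'"
        using fa pos_def_on_cong[of "insert j (pa E j)" ?M ?M'] by (simp add: fa_def)
      show "?M' i j = ?M' j i" for i
        using sym[of i j] by (simp add: matrix_of_def)
      show "?M' i j = regress (pa E j) ?M' i j" if "i \<in> {Suc j..p} - pa E j" for i
      proof -
        have "i \<in> pr p E j" using that by (auto simp: pr_def verts_def)
        then show ?thesis
          using regress_above[of j i] completed_fromD(2)[OF S] by (simp add: M')
      qed
    qed (use pa_subset in auto)
    moreover have "insert j {Suc j..p} = {j..p}"
      using completed_fromD(2)[OF S] by auto
    ultimately show ?thesis by simp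
  qed
  have markov: "?M' i k = regress (pa E k) ?M' i k" if "k \<in> {j..p}" "i \<in> pr p E k" for i k
  proof (cases "k = j")
    case True
    then show ?thesis using regress_above[OF that] that by (simp add: M')
  next
    case False
    then have "k \<in> {Suc j..p}" "i \<in> {Suc j..p}" using that pr_subset[of k] by auto
    then show ?thesis
      using regress_above[OF that] completed_fromD(7)[OF S _ that(2)] above by simp
  qed
  have forced: "?S' (i, k) = Some (T i k)"
    if T: "T \<in> completions p E G" and ik: "(i, k) \<in> dom ?S'" for T i k
  proof -
    \<comment> \<open>\<open>T\<close> agrees with \<open>S\<close> wherever the regression reads,
      so the Markov property of \<open>T\<close> at \<open>j\<close> forces the filled
      value.\<close>
    have column: "regress (pa E j) ?M i j = T i j" if i: "i \<in> pr p E j" for i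
    proof -
      have agree: "?M l m = T l m" if "(l, m) \<in> fa E j \<times> fa E j \<union> pr p E j \<times> pa E j" for l m
        using completed_fromD(8)[OF S T, of l m] that fa_subset_dom pr_pa_subset_dom by blast
      have "regress (pa E j) ?M i j = regress (pa E j) T i j"
        by (rule regress_cong) (use i in \<open>auto intro!: agree simp: fa_def\<close>)
      then show ?thesis using completionD(4)[OF T j_in_verts i] by simp
    qed
    have T_sym: "T i j = T j i" if "i \<in> pr p E j" for i
      using pos_def_onD(1)[OF completionD(1)[OF T]] that j_in_verts by (auto simp: pr_def)
    have "?M' i k = T i k"
    proof (cases "k = j \<and> i \<in> pr p E j \<or> i = j \<and> k \<in> pr p E j")
      case True
      then show ?thesis using column T_sym j_notin_pr by (auto simp: M')
    next
      case False
      then have "(i, k) \<in> dom S"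
        using ik by (auto simp: fill_regress_def fill_column_def split: if_splits)
      then show ?thesis
        using False completed_fromD(8)[OF S T] by (auto simp: M')
    qed
    then show ?thesis using matrix_of_inside[OF ik] by simp
  qed
  show ?thesis
    unfolding completed_from_def
  proof (intro conjI ballI allI)
    show "?S' (i, k) = ?S' (k, i)" for i k by (rule sym)
    show "?M' i k = regress (pa E k) ?M' i k" if "k \<in> {j..p}" "i \<in> pr p E k" for i k
      using that by (rule markov)
    show "case e of (i, k) \<Rightarrow> ?S' (i, k) = Some (T i k)"
      if "T \<in> completions p E G" "e \<in> dom ?S'" for T e
      using that forced by (cases e) simp
  qed (use j completed_fromD(2)[OF S] dom old pd in simp_all)
qed

end

text \<open>At vertex 1 the invariant covers everything: its Markov clauses give membership in
  \<open>PD\<close>, its forcing clause gives uniqueness, and both matrices vanish off the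
  vertices.\<close>

lemma completed_from_1:
  assumes S: "completed_from 1 S"
  shows "dom S = verts p \<times> verts p" "matrix_of S \<in> completions p E G"
    and "T \<in> completions p E G \<Longrightarrow> T = matrix_of S"
proof -
  show dom: "dom S = verts p \<times> verts p"
    using completed_fromD(3)[OF S] undirected_verts by (auto simp: verts_def)
  have "matrix_of S \<in> PD p E"
    unfolding PD_def
    using completed_fromD(6,7)[OF S] dom by (auto simp: verts_def matrix_of_outside)
  moreover have "G (i, k) = Some (matrix_of S i k)" if "(i, k) \<in> E" for i k
  proof -
    have "(i, k) \<in> undirected E" using that by (simp add: undirected_def)
    moreover from this have "(i, k) \<in> dom S" using completed_fromD(3)[OF S] by blast
    ultimately show ?thesis
      using completed_fromD(5)[OF S] matrix_of_inside by metis
  qed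
  ultimately show "matrix_of S \<in> completions p E G"
    by (auto simp: completions_def)
  show "T = matrix_of S" if T: "T \<in> completions p E G"
  proof (intro ext)
    fix i k
    show "T i k = matrix_of S i k"
    proof (cases "(i, k) \<in> dom S")
      case True
      then show ?thesis using completed_fromD(8)[OF S T] by simp
    next
      case False
      then show ?thesis using dom completionD(3)[OF T, of i k] by (simp add: matrix_of_outside)
    qed
  qed
qed

text \<open>In steps 3 to 5 the vertex has been decremented but its column is not yet filled, hence
  \<open>Suc j\<close>.\<close>

fun config_inv :: "config \<Rightarrow> bool" where
  "config_inv (Step2, j, S) = completed_from j S"
| "config_inv (Step3, j, S) = (1 \<le> j \<and> completed_from (Suc j) S)"
| "config_inv (Step4, j, S) =
    (1 \<le> j \<and> completed_from (Suc j) S \<and> pos_def_on (fa E j) (matrix_of S))"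
| "config_inv (Step5, j, S) =
    (1 \<le> j \<and> completed_from (Suc j) S \<and> pos_def_on (fa E j) (matrix_of S))"
| "config_inv (Completed, j, S) = completed_from 1 S"
| "config_inv (No_Completion, j, S) = (completions p E G = {})"

lemma config_inv_step:
  assumes "config_inv c"
  shows "config_inv (process_step p E c)"
proof -
  obtain st j S where c: "c = (st, j, S)" by (cases c) auto
  show ?thesis
  proof (cases st)
    case Step2
    then show ?thesis
      using assms completed_fromD(1)[of j S] by (cases "j = 1") (auto simp: c)
  next
    case Step3
    then show ?thesis
      using assms completion_imp_fa_pos_def[of j S] by (auto simp: c)
  next
    case Step4
    have "fill_regress p E j S = S" if "pr p E j = {}"
      using that by (auto simp: fill_regress_def fill_column_def)
    then show ?thesis
      using Step4 assms completed_from_fill[of j S] by (auto simp: c)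
  next
    case Step5
    have "fill_regress p E j S = fill_column p E j (\<lambda>i. 0) S" if "pa E j = {}"
      using that by (simp add: fill_regress_def)
    then show ?thesis
      using Step5 assms completed_from_fill[of j S] by (auto simp: c fill_regress_def)
  qed (use assms in \<open>simp_all add: c\<close>)
qed

lemma config_inv_process: "config_inv (process p E G n)"
  by (induction n) (simp_all add: process_def completed_from_initial config_inv_step)

end

section \<open>Termination of the process\<close>

fun config_measure :: "config \<Rightarrow> nat" where
  "config_measure (Step2, j, S) = 4 * j + 1"
| "config_measure (Step3, j, S) = 4 * j + 4"
| "config_measure (Step4, j, S) = 4 * j + 3"
| "config_measure (Step5, j, S) = 4 * j + 2"
| "config_measure (Completed, j, S) = 0"
| "config_measure (No_Completion, j, S) = 0"

text \<open>Four units per vertex suffice: step 2 goes from \<open>4 * j + 1\<close> to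
  \<open>4 * (j - 1) + 4\<close>, and the later steps of the round lower the offset.\<close>

lemma config_measure_step:
  assumes "fst c \<notin> {Completed, No_Completion}"
  shows "config_measure (process_step p E c) < config_measure c"
proof -
  obtain st j S where c: "c = (st, j, S)" by (cases c) auto
  show ?thesis using assms by (cases st) (auto simp: c)
qed

lemma process_terminates: "\<exists>n. fst (process p E G n) \<in> {Completed, No_Completion}"
proof -
  have "\<exists>n. fst ((process_step p E ^^ n) c) \<in> {Completed, No_Completion}" for c
  proof (induction c rule: measure_induct_rule[where f = config_measure])
    case (less c)
    show ?case
    proof (cases "fst c \<in> {Completed, No_Completion}")
      case True
      then show ?thesis by (intro exI[of _ 0]) simp
    next
      case False
      from less[OF config_measure_step[OF False]] obtain n
        where "fst ((process_step p E ^^ n) (process_step p E c)) \<in> {Completed, No_Completion}"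
        by blast
      then show ?thesis by (intro exI[of _ "Suc n"]) (simp add: funpow_swap1)
    qed
  qed
  then show ?thesis by (simp add: process_def)
qed

section \<open>Executions with a cost bound\<close>

definition halts ::
    "(nat \<times> nat) set \<Rightarrow> com \<Rightarrow> state \<Rightarrow> nat \<Rightarrow> (state \<Rightarrow> bool) \<Rightarrow> bool" where
  "halts E c s B Q \<longleftrightarrow> (\<exists>n t. exec E c s n t \<and> n \<le> B \<and> Q t)"

lemma haltsI: "exec E c s n t \<Longrightarrow> n \<le> B \<Longrightarrow> Q t \<Longrightarrow> halts E c s B Q"
  unfolding halts_def by blast

lemma haltsE:
  assumes "halts E c s B Q"
  obtains n t where "exec E c s n t" "n \<le> B" "Q t"
  using assms unfolding halts_def by blast

lemma halts_mono:
  assumes "halts E c s B P" "B \<le> B'" "\<And>t. P t \<Longrightarrow> Q t"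
  shows "halts E c s B' Q"
  using assms unfolding halts_def by (meson le_trans)

lemma halts_Skip: "Q s \<Longrightarrow> halts E Skip s B Q"
  by (rule haltsI[OF exec.Skip]) simp_all

lemma halts_IAssign: "Q (set_ivar x (ival e s) s) \<Longrightarrow> halts E (IAssign x e) s B Q"
  by (rule haltsI[OF exec.IAssign]) simp_all

lemma halts_RAssign:
  assumes "rdefined e s" "rcost e \<le> B"
    and "Q (set_cell a (ival i s) (ival j s) (rval e s) s)"
  shows "halts E (RAssign a i j e) s B Q"
  using assms exec.RAssign by (blast intro: haltsI)

lemma halts_Seq:
  assumes "halts E c1 s B1 P" "\<And>s'. P s' \<Longrightarrow> halts E c2 s' B2 Q" "B1 + B2 \<le> B"
  shows "halts E (Seq c1 c2) s B Q"
  using assms(1)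
proof (rule haltsE)
  fix m s'
  assume c1: "exec E c1 s m s'" "m \<le> B1" and "P s'"
  from assms(2)[OF this(3)] show ?thesis
  proof (rule haltsE)
    fix n t
    assume "exec E c2 s' n t" "n \<le> B2" "Q t"
    with c1 assms(3) show ?thesis by (intro haltsI[of _ _ _ "m + n" t] exec.Seq) auto
  qed
qed

lemma halts_If:
  assumes "bdefined b s"
    and "bval E b s \<Longrightarrow> halts E c1 s B' Q" "\<not> bval E b s \<Longrightarrow> halts E c2 s B' Q"
    and "bcost b + B' \<le> B"
  shows "halts E (If b c1 c2) s B Q"
proof (cases "bval E b s")
  case True
  from assms(2)[OF True] obtain n t where "exec E c1 s n t" "n \<le> B'" "Q t"
    by (rule haltsE)
  then show ?thesis
    using exec.IfTrue[OF assms(1) True] assms(4) by (intro haltsI[of _ _ _ "bcost b + n" t]) auto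
next
  case False
  from assms(3)[OF False] obtain n t where "exec E c2 s n t" "n \<le> B'" "Q t"
    by (rule haltsE)
  then show ?thesis
    using exec.IfFalse[OF assms(1) False] assms(4) by (intro haltsI[of _ _ _ "bcost b + n" t]) auto
qed

text \<open>There are at most \<open>\<mu> s\<close> rounds, each paying for guard and body; the
  last summand is the failing guard.\<close>

lemma halts_While:
  fixes \<mu> :: "state \<Rightarrow> nat"
  assumes I: "I s"
    and defined: "\<And>s. I s \<Longrightarrow> bdefined b s"
    and body: "\<And>s. I s \<Longrightarrow> bval E b s \<Longrightarrow> halts E c s B (\<lambda>t. I t \<and> \<mu> t < \<mu> s)"
  shows "halts E (While b c) s (\<mu> s * (bcost b + B) + bcost b) (\<lambda>t. I t \<and> \<not> bval E b t)"
  using I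
proof (induction s rule: measure_induct_rule[where f = \<mu>])
  case (less s)
  show ?case
  proof (cases "bval E b s")
    case True
    from body[OF less.prems True] obtain m s'
      where c: "exec E c s m s'" "m \<le> B" and s': "I s'" "\<mu> s' < \<mu> s"
      by (auto elim: haltsE)
    from less.IH[OF s'(2,1)] obtain n t
      where w: "exec E (While b c) s' n t" "n \<le> \<mu> s' * (bcost b + B) + bcost b"
        and t: "I t \<and> \<not> bval E b t"
      by (rule haltsE)
    have "Suc (\<mu> s') * (bcost b + B) \<le> \<mu> s * (bcost b + B)"
      using s'(2) by (intro mult_right_mono) auto
    then have "bcost b + m + n \<le> \<mu> s * (bcost b + B) + bcost b"
      using c w by simp
    with exec.WhileTrue[OF defined[OF less.prems] True c(1) w(1)] show ?thesis
      using t by (rule haltsI)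
  next
    case False
    with exec.WhileFalse[OF defined[OF less.prems] False] less.prems show ?thesis
      by (intro haltsI) auto
  qed
qed

lemma set_ivar_simps [simp]:
  "ivar (set_ivar x n s) = (ivar s)(x := n)" "cell (set_ivar x n s) = cell s"
  by (simp_all add: set_ivar_def)

lemma set_cell_simps [simp]:
  "ivar (set_cell a i j r s) = ivar s"
  "cell (set_cell a i j r s) = (cell s)(a := (cell s a)(i := (cell s a i)(j := r)))"
  by (simp_all add: set_cell_def)

text \<open>The loop runs over \<open>x = 1, \<dots>, p\<close>; register 0 holds \<open>p\<close> throughout.\<close>

definition For :: "nat \<Rightarrow> com \<Rightarrow> com" where
  "For x c = Seq (IAssign x (IConst 0))
     (While (ILess (IVar x) (IVar 0)) (Seq (IAssign x (IAdd (IVar x) (IConst 1))) c))"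

text \<open>\<open>I i\<close> holds after \<open>i\<close> rounds. The counter is incremented
  before the body, which thus runs with \<open>Suc i\<close>.\<close>

lemma halts_For:
  assumes x: "x \<noteq> 0" and p: "ivar s 0 = p"
    and init: "I 0 (set_ivar x 0 s)"
    and body: "\<And>i s. I i s \<Longrightarrow> ivar s 0 = p \<Longrightarrow> i < p \<Longrightarrow> ivar s x = i \<Longrightarrow>
      halts E c (set_ivar x (Suc i) s) B (\<lambda>t. I (Suc i) t \<and> ivar t 0 = p \<and> ivar t x = Suc i)"
    and post: "\<And>t. I p t \<Longrightarrow> ivar t 0 = p \<Longrightarrow> Q t"
    and B: "p * (B + 1) + 1 \<le> B'"
  shows "halts E (For x c) s B' Q"
  unfolding For_def
proof (rule halts_Seq)
  let ?J = "\<lambda>t. I (ivar t x) t \<and> ivar t 0 = p \<and> ivar t x \<le> p"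
  show "halts E (IAssign x (IConst 0)) s 0 (\<lambda>t. ?J t \<and> ivar t x = 0)"
    by (rule halts_IAssign) (use x p init in simp)
  show "halts E (While (ILess (IVar x) (IVar 0)) (Seq (IAssign x (IAdd (IVar x) (IConst 1))) c)) t
      (p * (1 + B) + 1) Q" if J: "?J t \<and> ivar t x = 0" for t
  proof (rule halts_mono[OF halts_While[where I = ?J and \<mu> = "\<lambda>t. p - ivar t x" and B = B]])
    fix s
    assume s: "?J s" "bval E (ILess (IVar x) (IVar 0)) s"
    show "halts E (Seq (IAssign x (IAdd (IVar x) (IConst 1))) c) s B
        (\<lambda>t. ?J t \<and> p - ivar t x < p - ivar s x)"
    proof (rule halts_Seq)
      show "halts E (IAssign x (IAdd (IVar x) (IConst 1))) s 0
          (\<lambda>t. t = set_ivar x (Suc (ivar s x)) s)"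
        by (rule halts_IAssign) simp
      show "halts E c t B (\<lambda>t. ?J t \<and> p - ivar t x < p - ivar s x)"
        if "t = set_ivar x (Suc (ivar s x)) s" for t
        unfolding that by (rule halts_mono[OF body[OF _ _ _ refl]]) (use s in auto)
    qed simp
  qed (use J post in auto)
  show "0 + (p * (1 + B) + 1) \<le> B'" using B by simp
qed


section \<open>The program\<close>

text \<open>The expression \<open>e\<close> may refer to the row and column index by registers 4 and 5.\<close>

definition Fill :: "nat \<Rightarrow> rexp \<Rightarrow> com" where
  "Fill a e = For 4 (For 5 (RAssign a (IVar 4) (IVar 5) e))"

text \<open>\<open>e\<close> has to evaluate to \<open>f\<close> in every state that agrees with
  \<open>s\<close> off the counters and off array \<open>a\<close>; so no entry depends on those
  already written.\<close>

lemma halts_Fill: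
  assumes p: "ivar s 0 = p"
    and e: "\<And>u i l. (\<And>x. x \<notin> {4, 5} \<Longrightarrow> ivar u x = ivar s x) \<Longrightarrow>
        (\<And>b. b \<noteq> a \<Longrightarrow> cell u b = cell s b) \<Longrightarrow> ivar u 4 = i \<Longrightarrow> ivar u 5 = l \<Longrightarrow>
        i \<in> verts p \<Longrightarrow> l \<in> verts p \<Longrightarrow> rdefined e u \<and> rval e u = f i l"
    and post: "\<And>t. (\<And>x. x \<notin> {4, 5} \<Longrightarrow> ivar t x = ivar s x) \<Longrightarrow>
        (\<And>b. b \<noteq> a \<Longrightarrow> cell t b = cell s b) \<Longrightarrow>
        (\<And>i l. i \<in> verts p \<Longrightarrow> l \<in> verts p \<Longrightarrow> cell t a i l = f i l) \<Longrightarrow> Q t"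
    and B: "p * (p * (rcost e + 1) + 2) + 1 \<le> B"
  shows "halts E (Fill a e) s B Q"
proof -
  define frame where "frame t \<longleftrightarrow> (\<forall>x. x \<notin> {4, 5} \<longrightarrow> ivar t x = ivar s x) \<and>
    (\<forall>b. b \<noteq> a \<longrightarrow> cell t b = cell s b)" for t :: state
  \<comment> \<open>\<open>I\<close> records the finished rows, \<open>J\<close> the finished part
    of the current row.\<close>
  define I where "I i t \<longleftrightarrow> frame t \<and>
    (\<forall>i'\<in>{1..i}. \<forall>l\<in>verts p. cell t a i' l = f i' l)" for i and t :: state
  define J where "J i l t \<longleftrightarrow> I i t \<and> ivar t 4 = Suc i \<and>
    (\<forall>l'\<in>{1..l}. cell t a (Suc i) l' = f (Suc i) l')" for i l and t :: state
  show ?thesis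
    unfolding Fill_def
  proof (rule halts_For[where I = I and B = "p * (rcost e + 1) + 1"])
    fix i u
    assume I: "I i u" "ivar u 0 = p" "i < p"
    show "halts E (For 5 (RAssign a (IVar 4) (IVar 5) e)) (set_ivar 4 (Suc i) u)
        (p * (rcost e + 1) + 1) (\<lambda>t. I (Suc i) t \<and> ivar t 0 = p \<and> ivar t 4 = Suc i)"
    proof (rule halts_For[where I = "J i" and B = "rcost e"])
      show "J i 0 (set_ivar 5 0 (set_ivar 4 (Suc i) u))"
        using I by (simp add: J_def I_def frame_def)
    next
      fix l v
      assume J: "J i l v" "ivar v 0 = p" "l < p"
      let ?v = "set_ivar 5 (Suc l) v"
      have "rdefined e ?v \<and> rval e ?v = f (Suc i) (Suc l)"
        by (rule e) (use J I(3) in \<open>auto simp: J_def I_def frame_def verts_def\<close>)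
      then show "halts E (RAssign a (IVar 4) (IVar 5) e) ?v (rcost e)
          (\<lambda>t. J i (Suc l) t \<and> ivar t 0 = p \<and> ivar t 5 = Suc l)"
        by (intro halts_RAssign)
          (use J in \<open>auto simp: J_def I_def frame_def le_Suc_eq\<close>)
    next
      fix t
      assume J: "J i p t" and "ivar t 0 = p"
      have "cell t a i' l = f i' l" if "i' \<in> {1..Suc i}" "l \<in> verts p" for i' l
        using that J by (cases "i' = Suc i") (auto simp: J_def I_def verts_def)
      then show "I (Suc i) t \<and> ivar t 0 = p \<and> ivar t 4 = Suc i"
        using J \<open>ivar t 0 = p\<close> by (simp add: J_def I_def)
    qed (use I in auto)
  next
    show "I 0 (set_ivar 4 0 s)" by (simp add: I_def frame_def)
    show "Q t" if "I p t" for t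
      using that by (intro post) (auto simp: I_def frame_def verts_def)
  qed (use p B in auto)
qed

text \<open>
  The pivot index is in register 3. The result goes through array 2, since the pivot row and column
  of array 1 must not change while they are being used.
\<close>

definition Eliminate :: com where
  "Eliminate = Seq
    (Fill 2 (RSub (Cell 1 (IVar 4) (IVar 5))
      (RDiv (RMul (Cell 1 (IVar 4) (IVar 3)) (Cell 1 (IVar 3) (IVar 5)))
        (Cell 1 (IVar 3) (IVar 3)))))
    (Fill 1 (Cell 2 (IVar 4) (IVar 5)))"

text \<open>The 4 is three operations of the update and one loop test; copying back costs only
  tests.\<close>

definition eliminate_cost :: "nat \<Rightarrow> nat" where
  "eliminate_cost p = (p * (p * 4 + 2) + 1) + (p * (p + 2) + 1)"

lemma halts_Eliminate:
  assumes p: "ivar s 0 = p" and k: "ivar s 3 = k" "k \<in> verts p"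
    and M: "\<And>i l. i \<in> verts p \<Longrightarrow> l \<in> verts p \<Longrightarrow> cell s 1 i l = M i l"
    and pivot: "M k k \<noteq> 0"
    and post: "\<And>t. (\<And>x. x \<notin> {4, 5} \<Longrightarrow> ivar t x = ivar s x) \<Longrightarrow> cell t 0 = cell s 0 \<Longrightarrow>
        (\<And>i l. i \<in> verts p \<Longrightarrow> l \<in> verts p \<Longrightarrow>
          cell t 1 i l = M i l - M i k * M k l / M k k) \<Longrightarrow> Q t"
  shows "halts E Eliminate s (eliminate_cost p) Q"
  unfolding Eliminate_def eliminate_cost_def
proof (rule halts_Seq[OF _ _ order_refl])
  let ?P = "\<lambda>t. (\<forall>x. x \<notin> {4, 5} \<longrightarrow> ivar t x = ivar s x) \<and> cell t 0 = cell s 0 \<and>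
    (\<forall>i\<in>verts p. \<forall>l\<in>verts p. cell t 2 i l = M i l - M i k * M k l / M k k)"
  show "halts E (Fill 2 (RSub (Cell 1 (IVar 4) (IVar 5))
      (RDiv (RMul (Cell 1 (IVar 4) (IVar 3)) (Cell 1 (IVar 3) (IVar 5)))
        (Cell 1 (IVar 3) (IVar 3))))) s (p * (p * 4 + 2) + 1) ?P"
    by (rule halts_Fill[where f = "\<lambda>i l. M i l - M i k * M k l / M k k" and p = p])
      (use p k M pivot in auto)
  show "halts E (Fill 1 (Cell 2 (IVar 4) (IVar 5))) s' (p * (p + 2) + 1) Q" if "?P s'" for s'
    by (rule halts_Fill[where f = "\<lambda>i l. M i l - M i k * M k l / M k k" and p = p])
      (use that p in \<open>auto intro!: post\<close>)
qed

text \<open>The vertex \<open>j\<close> is in register 2.\<close>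

definition Eliminate_parents :: com where
  "Eliminate_parents = Seq (Fill 1 (Cell 0 (IVar 4) (IVar 5)))
    (For 3 (If (BAnd (Edge (IVar 3) (IVar 2)) (ILess (IVar 2) (IVar 3))) Eliminate Skip))"

definition parents_cost :: "nat \<Rightarrow> nat" where
  "parents_cost p = (p * (p + 2) + 1) + (p * (eliminate_cost p + 3) + 1)"

text \<open>Array 1 holds minus the values to be filled in, hence the subtraction from zero.\<close>

definition Fill_column :: com where
  "Fill_column = For 4 (If (BAnd (ILess (IVar 2) (IVar 4)) (BNot (Edge (IVar 4) (IVar 2))))
    (Seq (RAssign 0 (IVar 4) (IVar 2) (RSub RZero (Cell 1 (IVar 4) (IVar 2))))
      (RAssign 0 (IVar 2) (IVar 4) (RSub RZero (Cell 1 (IVar 4) (IVar 2))))) Skip)"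

text \<open>The diagonal entry left by the elimination is the Schur complement, whose sign replaces
  the test of step (3).\<close>

definition Round :: com where
  "Round = Seq (IAssign 2 (ISub (IVar 2) (IConst 1))) (Seq Eliminate_parents
    (If (RLess RZero (Cell 1 (IVar 2) (IVar 2))) Fill_column (IAssign 1 (IConst 0))))"

definition round_cost :: "nat \<Rightarrow> nat" where
  "round_cost p = parents_cost p + (1 + (p * 5 + 1))"

text \<open>Register 1 is both the answer and the flag that stops the loop after a failure.\<close>

definition Complete :: com where
  "Complete = Seq (IAssign 2 (IVar 0)) (Seq (IAssign 1 (IConst 1))
    (While (BAnd (ILess (IConst 1) (IVar 2)) (ILess (IConst 0) (IVar 1))) Round))"

section \<open>Correctness and cost of the program\<close>

context dag_partial_matrix
begin

lemma halts_Eliminate_parents: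
  assumes S: "completed_from (Suc j) S" and j: "1 \<le> j"
    and s: "ivar s 0 = p" "ivar s 2 = j" "cell s 0 = matrix_of S"
    and post: "\<And>t. (\<And>x. x < 3 \<Longrightarrow> ivar t x = ivar s x) \<Longrightarrow> cell t 0 = matrix_of S \<Longrightarrow>
      (\<And>i l. i \<in> verts p \<Longrightarrow> l \<in> verts p \<Longrightarrow>
        cell t 1 i l = matrix_of S i l - regress (pa E j) (matrix_of S) i l) \<Longrightarrow> Q t"
  shows "halts E Eliminate_parents s (parents_cost p) Q"
  unfolding Eliminate_parents_def parents_cost_def
proof (rule halts_Seq[OF _ _ order_refl])
  let ?M = "matrix_of S"
  let ?A = "\<lambda>k. pa E j \<inter> {..k}"
  \<comment> \<open>After \<open>k\<close> rounds exactly the parents up to \<open>k\<close> have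
    been eliminated.\<close>
  define I where "I k t \<longleftrightarrow> (\<forall>x<3. ivar t x = ivar s x) \<and> cell t 0 = ?M \<and>
    (\<forall>i\<in>verts p. \<forall>l\<in>verts p. cell t 1 i l = ?M i l - regress (?A k) ?M i l)" for k and t :: state
  have A0: "?A 0 = {}" using pa_subset[of j] by auto
  have Ap: "?A p = pa E j" using pa_subset[of j] by auto
  show "halts E (Fill 1 (Cell 0 (IVar 4) (IVar 5))) s (p * (p + 2) + 1) (I 0)"
    by (rule halts_Fill[where f = ?M and p = p]) (use s A0 in \<open>auto simp: I_def\<close>)
  fix s'
  assume I0: "I 0 s'"
  show "halts E (For 3 (If (BAnd (Edge (IVar 3) (IVar 2)) (ILess (IVar 2) (IVar 3)))
    Eliminate Skip)) s' (p * (eliminate_cost p + 3) + 1) Q"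
  proof (rule halts_For[where I = I and B = "eliminate_cost p + 2"])
    fix k u
    assume I: "I k u" "ivar u 0 = p" "k < p"
    let ?u = "set_ivar 3 (Suc k) u"
    \<comment> \<open>Edge sets contain loops; the comparison of indices keeps \<open>j\<close> from
      counting as its own parent.\<close>
    have guard: "bval E (BAnd (Edge (IVar 3) (IVar 2)) (ILess (IVar 2) (IVar 3))) ?u
        \<longleftrightarrow> Suc k \<in> pa E j"
      using I s pa_subset[of j] by (auto simp: I_def pa_def)
    show "halts E (If (BAnd (Edge (IVar 3) (IVar 2)) (ILess (IVar 2) (IVar 3))) Eliminate Skip)
        ?u (eliminate_cost p + 2) (\<lambda>t. I (Suc k) t \<and> ivar t 0 = p \<and> ivar t 3 = Suc k)"
    proof (rule halts_If)
      assume "bval E (BAnd (Edge (IVar 3) (IVar 2)) (ILess (IVar 2) (IVar 3))) ?u"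
      then have k: "Suc k \<in> pa E j" using guard by blast
      have A: "?A (Suc k) = insert (Suc k) (?A k)"
        using k by auto
      have pd: "pos_def_on (insert (Suc k) (?A k)) ?M"
        using pos_def_on_subset[OF pos_def_on_pa[OF S j] _ finite_pa, of "?A (Suc k)"] A by auto
      note insert = regress_insert[OF _ _ pd]
      show "halts E Eliminate ?u (eliminate_cost p)
          (\<lambda>t. I (Suc k) t \<and> ivar t 0 = p \<and> ivar t 3 = Suc k)"
      proof (rule halts_Eliminate[where k = "Suc k" and M = "\<lambda>i l. ?M i l - regress (?A k) ?M i l"])
        show "?M (Suc k) (Suc k) - regress (?A k) ?M (Suc k) (Suc k) \<noteq> 0"
          using insert(1) by force
        fix t :: state
        assume t: "\<And>x. x \<notin> {4, 5} \<Longrightarrow> ivar t x = ivar ?u x" "cell t 0 = cell ?u 0"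
          and t1: "\<And>i l. i \<in> verts p \<Longrightarrow> l \<in> verts p \<Longrightarrow> cell t 1 i l =
            ?M i l - regress (?A k) ?M i l - (?M i (Suc k) - regress (?A k) ?M i (Suc k)) *
            (?M (Suc k) l - regress (?A k) ?M (Suc k) l) /
            (?M (Suc k) (Suc k) - regress (?A k) ?M (Suc k) (Suc k))"
        have "cell t 1 i l = ?M i l - regress (?A (Suc k)) ?M i l"
          if "i \<in> verts p" "l \<in> verts p" for i l
          using t1[OF that] unfolding A by (subst insert(2)) auto
        then show "I (Suc k) t \<and> ivar t 0 = p \<and> ivar t 3 = Suc k"
          using t I by (auto simp: I_def)
      qed (use I in \<open>auto simp: I_def verts_def\<close>)
    next
      assume "\<not> bval E (BAnd (Edge (IVar 3) (IVar 2)) (ILess (IVar 2) (IVar 3))) ?u"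
      then have "Suc k \<notin> pa E j" using guard by blast
      then have "?A (Suc k) = ?A k" by (auto simp: le_Suc_eq)
      then show "halts E Skip ?u (eliminate_cost p)
          (\<lambda>t. I (Suc k) t \<and> ivar t 0 = p \<and> ivar t 3 = Suc k)"
        by (intro halts_Skip) (use I in \<open>auto simp: I_def\<close>)
    qed simp_all
  next
    show "Q t" if "I p t" for t
      using that by (intro post) (auto simp: I_def Ap)
  qed (use I0 s in \<open>auto simp: I_def algebra_simps\<close>)
qed

lemma halts_Fill_column:
  assumes S: "completed_from (Suc j) S" and j: "1 \<le> j"
    and s: "ivar s 0 = p" "ivar s 2 = j" "cell s 0 = matrix_of S"
    and s1: "\<And>i l. i \<in> verts p \<Longrightarrow> l \<in> verts p \<Longrightarrow>
        cell s 1 i l = matrix_of S i l - regress (pa E j) (matrix_of S) i l"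
    and post: "\<And>t. (\<And>x. x < 3 \<Longrightarrow> ivar t x = ivar s x) \<Longrightarrow>
      cell t 0 = matrix_of (fill_regress p E j S) \<Longrightarrow> Q t"
  shows "halts E Fill_column s (p * 5 + 1) Q"
  unfolding Fill_column_def
proof -
  let ?M = "matrix_of S" and ?r = "\<lambda>i. regress (pa E j) (matrix_of S) i j"
  \<comment> \<open>Array 0 after \<open>n\<close> rounds: of the entries to be filled, those with
    index up to \<open>n\<close> are in place.\<close>
  define F where "F n i l = (if l = j \<and> i \<in> pr p E j \<and> i \<le> n then ?r i
      else if i = j \<and> l \<in> pr p E j \<and> l \<le> n then ?r l else ?M i l)" for n i l
  define I where "I n t \<longleftrightarrow> (\<forall>x<3. ivar t x = ivar s x) \<and> cell t 1 = cell s 1 \<and> cell t 0 = F n"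
    for n and t :: state
  have pr: "i \<in> pr p E j \<longleftrightarrow> j < i \<and> i \<le> p \<and> (i, j) \<notin> E" for i
    using j by (auto simp: pr_def pa_def verts_def)
  have F0: "F 0 = ?M"
    by (intro ext) (auto simp: F_def pr)
  have F_skip: "F (Suc i) = F i" if "Suc i \<notin> pr p E j" for i
    using that by (intro ext) (auto simp: F_def le_Suc_eq)
  have F_step: "F (Suc i) = ((F i)(Suc i := (F i (Suc i))(j := ?r (Suc i))))
      (j := (((F i)(Suc i := (F i (Suc i))(j := ?r (Suc i)))) j)(Suc i := ?r (Suc i)))"
    if "Suc i \<in> pr p E j" for i
    using that by (intro ext) (auto simp: F_def le_Suc_eq pr)
  have Fp: "F p = matrix_of (fill_regress p E j S)"
    by (intro ext) (auto simp: F_def fill_regress_def matrix_of_fill_column pr)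
  let ?b = "BAnd (ILess (IVar 2) (IVar 4)) (BNot (Edge (IVar 4) (IVar 2)))"
  let ?e = "RSub RZero (Cell 1 (IVar 4) (IVar 2))"
  show "halts E (For 4 (If ?b (Seq (RAssign 0 (IVar 4) (IVar 2) ?e)
      (RAssign 0 (IVar 2) (IVar 4) ?e)) Skip)) s (p * 5 + 1) Q"
  \<comment> \<open>The 4 is two comparisons in the guard and two subtractions.\<close>
  proof (rule halts_For[where I = I and B = 4])
    fix i u
    assume I: "I i u" "ivar u 0 = p" "i < p"
    let ?u = "set_ivar 4 (Suc i) u"
    have guard: "bval E ?b ?u \<longleftrightarrow> Suc i \<in> pr p E j"
      using I s by (simp add: I_def pr)
    show "halts E (If ?b (Seq (RAssign 0 (IVar 4) (IVar 2) ?e)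
      (RAssign 0 (IVar 2) (IVar 4) ?e)) Skip) ?u 4
      (\<lambda>t. I (Suc i) t \<and> ivar t 0 = p \<and> ivar t 4 = Suc i)"
    proof (rule halts_If)
      assume "bval E ?b ?u"
      then have i: "Suc i \<in> pr p E j" using guard by blast
      have "?M (Suc i) j = 0"
        using pr_not_dom[OF S j i] by (rule matrix_of_outside)
      moreover have "Suc i \<in> verts p" "j \<in> verts p"
        using i j by (auto simp: pr verts_def)
      ultimately have r: "cell u 1 (Suc i) j = - ?r (Suc i)"
        using s1[of "Suc i" j] I by (simp add: I_def)
      let ?v = "set_cell 0 (Suc i) j (?r (Suc i)) ?u"
      show "halts E (Seq (RAssign 0 (IVar 4) (IVar 2) ?e) (RAssign 0 (IVar 2) (IVar 4) ?e)) ?u 2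
          (\<lambda>t. I (Suc i) t \<and> ivar t 0 = p \<and> ivar t 4 = Suc i)"
      proof (rule halts_Seq)
        show "halts E (RAssign 0 (IVar 4) (IVar 2) ?e) ?u 1 (\<lambda>t. t = ?v)"
          by (rule halts_RAssign) (use I s r in \<open>auto simp: I_def\<close>)
        show "halts E (RAssign 0 (IVar 2) (IVar 4) ?e) v 1
            (\<lambda>t. I (Suc i) t \<and> ivar t 0 = p \<and> ivar t 4 = Suc i)" if "v = ?v" for v
          unfolding that
          by (rule halts_RAssign) (use I s r F_step[OF i] in \<open>auto simp: I_def\<close>)
      qed simp
    next
      assume "\<not> bval E ?b ?u"
      then have "Suc i \<notin> pr p E j" using guard by blast
      then show "halts E Skip ?u 2 (\<lambda>t. I (Suc i) t \<and> ivar t 0 = p \<and> ivar t 4 = Suc i)"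
        by (intro halts_Skip) (use I F_skip in \<open>auto simp: I_def\<close>)
    qed simp_all
  next
    show "Q t" if "I p t" for t
      using that by (intro post) (auto simp: I_def Fp)
    show "I 0 (set_ivar 4 0 s)"
      using s(3) F0 by (simp add: I_def)
  qed (simp_all add: s(1))
qed

text \<open>Array 1 is rebuilt from array 0 in every round, so nothing about it has to be carried
  over.\<close>

definition round_inv :: "state \<Rightarrow> bool" where
  "round_inv s \<longleftrightarrow> ivar s 0 = p \<and>
    (ivar s 1 = 1 \<and> (\<exists>S. completed_from (ivar s 2) S \<and> cell s 0 = matrix_of S) \<or>
     ivar s 1 = 0 \<and> completions p E G = {})"

text \<open>The product of flag and vertex drops either way: success lowers the vertex, failure
  clears the flag.\<close>

lemma halts_Round:
  assumes inv: "round_inv s" and s: "1 < ivar s 2" "0 < ivar s 1"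
  shows "halts E Round s (round_cost p)
    (\<lambda>t. round_inv t \<and> ivar t 1 * ivar t 2 < ivar s 1 * ivar s 2)"
proof -
  define j where "j = ivar s 2 - 1"
  have j: "1 \<le> j" "ivar s 2 = Suc j" using s by (simp_all add: j_def)
  have s_ivar: "ivar s 0 = p" "ivar s 1 = 1" "ivar s 2 = Suc j"
    using inv s j unfolding round_inv_def by auto
  then obtain S where S: "completed_from (Suc j) S" and s0: "cell s 0 = matrix_of S"
    using inv unfolding round_inv_def by auto
  note j = j(1)
  let ?M = "matrix_of S"
  let ?Q = "\<lambda>t. round_inv t \<and> ivar t 1 * ivar t 2 < ivar s 1 * ivar s 2"
  let ?u = "set_ivar 2 j s"
  define P where "P t \<longleftrightarrow> (\<forall>x<3. ivar t x = ivar ?u x) \<and> cell t 0 = ?M \<and>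
    (\<forall>i\<in>verts p. \<forall>l\<in>verts p. cell t 1 i l = ?M i l - regress (pa E j) ?M i l)" for t :: state
  show ?thesis
    unfolding Round_def round_cost_def
  proof (rule halts_Seq)
    show "halts E (IAssign 2 (ISub (IVar 2) (IConst 1))) s 0 (\<lambda>t. t = ?u)"
      by (rule halts_IAssign) (simp add: j_def)
    show "halts E (Seq Eliminate_parents
        (If (RLess RZero (Cell 1 (IVar 2) (IVar 2))) Fill_column (IAssign 1 (IConst 0)))) u
        (parents_cost p + (1 + (p * 5 + 1))) ?Q" if u: "u = ?u" for u
      unfolding u
    proof (rule halts_Seq[OF _ _ order_refl])
      show "halts E Eliminate_parents ?u (parents_cost p) P"
        by (rule halts_Eliminate_parents[OF S j]) (use s_ivar s0 in \<open>auto simp: P_def\<close>)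
      fix t
      assume P: "P t"
      have "j \<in> verts p" using j_in_verts[OF S j] .
      then have guard: "bval E (RLess RZero (Cell 1 (IVar 2) (IVar 2))) t \<longleftrightarrow>
          pos_def_on (fa E j) ?M"
        unfolding fa_pos_def_iff[OF S j] using P by (simp add: P_def)
      show "halts E (If (RLess RZero (Cell 1 (IVar 2) (IVar 2))) Fill_column
          (IAssign 1 (IConst 0))) t (1 + (p * 5 + 1)) ?Q"
      proof (rule halts_If)
        assume "bval E (RLess RZero (Cell 1 (IVar 2) (IVar 2))) t"
        then have "completed_from j (fill_regress p E j S)"
          unfolding guard by (rule completed_from_fill[OF S j])
        then show "halts E Fill_column t (p * 5 + 1) ?Q"
          by (intro halts_Fill_column[OF S j])
            (use P s_ivar in \<open>auto simp: P_def round_inv_def\<close>)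
      next
        assume "\<not> bval E (RLess RZero (Cell 1 (IVar 2) (IVar 2))) t"
        then have "completions p E G = {}"
          unfolding guard using completion_imp_fa_pos_def[OF S j] by blast
        then show "halts E (IAssign 1 (IConst 0)) t (p * 5 + 1) ?Q"
          by (intro halts_IAssign) (use P s_ivar in \<open>auto simp: P_def round_inv_def\<close>)
      qed simp_all
    qed
  qed simp
qed

text \<open>The measure starts at \<open>p\<close> and bounds the number of rounds; every guard
  costs two comparisons, including the final one.\<close>

lemma halts_Complete:
  "halts E Complete (input_state p G) (p * (2 + round_cost p) + 2) (correct_output p E G)"
  unfolding Complete_def
proof (rule halts_Seq)
  let ?b = "BAnd (ILess (IConst 1) (IVar 2)) (ILess (IConst 0) (IVar 1))"
  let ?s = "set_ivar 2 p (input_state p G)"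
  let ?u = "set_ivar 1 1 ?s"
  show "halts E (IAssign 2 (IVar 0)) (input_state p G) 0 (\<lambda>t. t = ?s)"
    by (rule halts_IAssign) (simp add: input_state_def)
  show "halts E (Seq (IAssign 1 (IConst 1)) (While ?b Round)) t (p * (2 + round_cost p) + 2)
    (correct_output p E G)" if t: "t = ?s" for t
    unfolding t
  proof (rule halts_Seq)
    show "halts E (IAssign 1 (IConst 1)) ?s 0 (\<lambda>t. t = ?u)"
      by (rule halts_IAssign) simp
    show "halts E (While ?b Round) u (p * (2 + round_cost p) + 2) (correct_output p E G)"
      if u: "u = ?u" for u
      unfolding u
    proof (rule halts_mono[OF halts_While[where I = round_inv and B = "round_cost p"
          and \<mu> = "\<lambda>t. ivar t 1 * ivar t 2"]])
      show "round_inv ?u"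
        using completed_from_initial by (auto simp: round_inv_def input_state_def)
      show "halts E Round s (round_cost p)
          (\<lambda>t. round_inv t \<and> ivar t 1 * ivar t 2 < ivar s 1 * ivar s 2)"
        if "round_inv s" "bval E ?b s" for s
        using that by (intro halts_Round) auto
      fix t
      assume t: "round_inv t \<and> \<not> bval E ?b t"
      show "correct_output p E G t"
      proof (cases "ivar t 1 = 1")
        case True
        with t obtain S where S: "completed_from (ivar t 2) S" and t0: "cell t 0 = matrix_of S"
          by (auto simp: round_inv_def)
        \<comment> \<open>The flag is still set, so the guard failed on the vertex, which the
          invariant keeps at least 1.\<close>
        have "ivar t 2 = 1"
          using t True completed_fromD(1)[OF S] by auto
        then have "matrix_of S \<in> completions p E G"
          using completed_from_1(2) S by simp
        then show ?thesis
          unfolding correct_output_def using True t0 by auto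
      next
        case False
        then show ?thesis using t by (auto simp: round_inv_def correct_output_def)
      qed
    qed simp_all
  qed simp
qed simp

end

section \<open>The polynomial bound and the theorem\<close>

definition cost_poly :: "nat poly" where
  "cost_poly = (let X = [:0, 1:];
     el = (X * (X * [:4:] + [:2:]) + [:1:]) + (X * (X + [:2:]) + [:1:]);
     pa = (X * (X + [:2:]) + [:1:]) + (X * (el + [:3:]) + [:1:])
   in X * ([:2:] + (pa + ([:1:] + (X * [:5:] + [:1:])))) + [:2:])"

text \<open>\<open>cost_poly\<close> copies the nesting of the cost functions, so evaluation matches
  term by term. Its degree is 4.\<close>

lemma poly_cost_poly: "poly cost_poly p = p * (2 + round_cost p) + 2"
  by (simp only: cost_poly_def Let_def round_cost_def parents_cost_def eliminate_cost_def
      poly_add poly_mult poly_pCons poly_0 mult_zero_right add_0_right add_0_left mult_1_right)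

theorem proposition3p3:
  shows "(\<exists>(c :: com) (q :: nat poly). \<forall>p E G. dag p E \<longrightarrow> G \<in> QD p E \<longrightarrow>
            (\<exists>n t. exec E c (input_state p G) n t \<and> n \<le> poly q p \<and> correct_output p E G t))
       \<and> (\<forall>p E G. dag p E \<longrightarrow> G \<in> QD p E \<longrightarrow>
            (completions p E G \<noteq> {} \<longrightarrow>
               (\<exists>!T. T \<in> completions p E G) \<and>
               (\<exists>n j S. process p E G n = (Completed, j, S) \<and>
                        matrix_of S \<in> completions p E G)) \<and>
            (\<exists>n. fst (process p E G n) \<in> {Completed, No_Completion}) \<and>
            (\<forall>n j S. process p E G n = (Completed, j, S) \<longrightarrow>
               dom S = verts p \<times> verts p \<and> matrix_of S \<in> completions p E G) \<and>
            (\<forall>n j S. process p E G n = (No_Completion, j, S) \<longrightarrow> completions p E G = {}) \<and>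
            (\<forall>n j S. process p E G n = (Step3, j, S) \<longrightarrow> fa E j \<times> fa E j \<subseteq> dom S) \<and>
            (\<forall>n j S. process p E G n = (Step5, j, S) \<longrightarrow> pr p E j \<times> pa E j \<subseteq> dom S))"
proof (intro conjI allI impI)
  \<comment> \<open>\<open>Complete\<close> and \<open>cost_poly\<close> do not depend on the graph,
    so one pair serves all inputs.\<close>
  have "\<exists>n t. exec E Complete (input_state p G) n t \<and> n \<le> poly cost_poly p \<and>
      correct_output p E G t" if "dag p E" "G \<in> QD p E" for p E G
  proof -
    interpret dag_partial_matrix p E G using that by unfold_locales
    show ?thesis using halts_Complete unfolding halts_def poly_cost_poly .
  qed
  then show "\<exists>(c :: com) (q :: nat poly). \<forall>p E G. dag p E \<longrightarrow> G \<in> QD p E \<longrightarrow>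
      (\<exists>n t. exec E c (input_state p G) n t \<and> n \<le> poly q p \<and> correct_output p E G t)"
    by blast
next
  fix p E G
  assume "dag p E" "G \<in> QD p E"
  then interpret dag_partial_matrix p E G by unfold_locales
  have inv: "config_inv (st, j, S)" if "process p E G n = (st, j, S)" for n st j S
    using config_inv_process[of n] that by simp
  show terminates: "\<exists>n. fst (process p E G n) \<in> {Completed, No_Completion}"
    by (rule process_terminates)
  show completed: "dom S = verts p \<times> verts p" "matrix_of S \<in> completions p E G"
    if "process p E G n = (Completed, j, S)" for n j S
    using inv[OF that] completed_from_1(1,2) by simp_all
  show failed: "completions p E G = {}" if "process p E G n = (No_Completion, j, S)" for n j S
    using inv[OF that] by simp
  show "fa E j \<times> fa E j \<subseteq> dom S" if "process p E G n = (Step3, j, S)" for n j S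
    using inv[OF that] fa_subset_dom by simp
  show "pr p E j \<times> pa E j \<subseteq> dom S" if "process p E G n = (Step5, j, S)" for n j S
    using inv[OF that] pr_pa_subset_dom by simp
  assume nonempty: "completions p E G \<noteq> {}"
  obtain n st j S where n: "process p E G n = (st, j, S)" "st \<in> {Completed, No_Completion}"
    using terminates by (metis prod.collapse)
  then have n_completed: "process p E G n = (Completed, j, S)"
    using failed nonempty by blast
  then show "\<exists>n j S. process p E G n = (Completed, j, S) \<and> matrix_of S \<in> completions p E G"
    using completed(2) by blast
  have "completed_from 1 S" using inv[OF n_completed] by simp
  then show "\<exists>!T. T \<in> completions p E G"
    using completed_from_1(2,3) by blast
qed

end
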